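(* Suppose the positive integer $m$ is of one of the following forms: (i) $m=p^\alpha$ with $p$ prime; (ii) $m=p^\alpha q^\beta$ with $p,q$ distinct primes; (iii) $m=2^\alpha p^\beta q^\gamma$ with $p,q$ distinct odd primes. Then the cyclotomic polytope $\mathcal{C}_m$ is totally unimodular.
   Context: A matrix with entries in $\{0,+1,-1\}$ is totally unimodular if every square submatrix has determinant $0$, $+1$ or $-1$; a lattice polytope is totally unimodular if the matrix whose columns are the lattice points of the polytope is totally unimodular. Cyclotomic polytopes: for $p$ prime, $\mathcal{C}_p=\operatorname{conv}(e_1,\dots,e_{p-1},-\sum_ie_i)\subset\mathbb{R}^{p-1}$; for $p$ prime and $\alpha\ge2$, with $\zeta=e^{2\pi i/p^\alpha}$, identify the $\mathbb{Z}$-basis element $\zeta^{k+jp^{\alpha-1}}$ ($0\le k\le p^{\alpha-1}-1$, $0\le j\le p-2$) with $e_{k(p-1)+j}\in\mathbb{R}^{\phi(p^\alpha)}$ and let $\mathcal{C}_{p^\alpha}$ be the convex hull of the points representing all powers of $\zeta$; for $m=m_1m_2$ with $m_1,m_2>1$ coprime, $\mathcal{C}_m=\mathcal{C}_{m_1}\otimes\mathcal{C}_{m_2}\subset\mathbb{R}^{\phi(m_1)}\otimes\mathbb{R}^{\phi(m_2)}$, where $P\otimes Q=\operatorname{conv}(v_i\otimes w_j)$ over vertices $v_i$ of $P$, $w_j$ of $Q$. *)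

theory Defs
  imports
    "HOL-Analysis.Finite_Function_Topology"
    "HOL-Analysis.Polytope"
    "HOL-Number_Theory.Totient"
    "Jordan_Normal_Form.Determinant"
    "Jordan_Normal_Form.DL_Submatrix"
begin

text \<open>
  The dimension of a cyclotomic polytope depends on \<open>m\<close>, so \<open>\<real>\<^sup>n\<close> is represented by the finitely
  supported functions \<open>nat \<Rightarrow>\<^sub>0 real\<close> whose support lies in \<open>{..<n}\<close>. These are a real vector space in
  the library, so that \<open>convex hull\<close> and \<open>extreme_point_of\<close> apply. Coordinates are counted from 0.
\<close>

definition lattice_point :: "nat \<Rightarrow> (nat \<Rightarrow>\<^sub>0 real) \<Rightarrow> bool" where
  "lattice_point n x \<longleftrightarrow> Poly_Mapping.keys x \<subseteq> {..<n} \<and> (\<forall>i. Poly_Mapping.lookup x i \<in> \<int>)"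

definition lattice_polytope :: "nat \<Rightarrow> (nat \<Rightarrow>\<^sub>0 real) set \<Rightarrow> bool" where
  "lattice_polytope n P \<longleftrightarrow> (\<exists>V. finite V \<and> (\<forall>v\<in>V. lattice_point n v) \<and> P = convex hull V)"


section \<open>Total unimodularity\<close>

definition totally_unimodular :: "real mat \<Rightarrow> bool" where
  "totally_unimodular A \<longleftrightarrow>
     elements_mat A \<subseteq> {0, 1, -1} \<and>
     (\<forall>I J. I \<subseteq> {..<dim_row A} \<and> J \<subseteq> {..<dim_col A} \<and> card I = card J \<longrightarrow>
        Determinant.det (submatrix A I J) \<in> {0, 1, -1})"

text \<open>
  The columns are indexed by an enumeration \<open>xs\<close> of all the lattice points of the polytope, the
  origin included if it belongs to it. Total unimodularity does not depend on the order of the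
  columns, so it does not matter which enumeration is taken.
\<close>

definition totally_unimodular_polytope :: "nat \<Rightarrow> (nat \<Rightarrow>\<^sub>0 real) set \<Rightarrow> bool" where
  "totally_unimodular_polytope n P \<longleftrightarrow>
     lattice_polytope n P \<and>
     (\<exists>xs. distinct xs \<and> set xs = {x \<in> P. lattice_point n x} \<and>
        totally_unimodular
          (Matrix.mat n (length xs) (\<lambda>(i, j). Poly_Mapping.lookup (xs ! j) i)))"


section \<open>Cyclotomic polytopes\<close>

abbreviation std_basis :: "nat \<Rightarrow> (nat \<Rightarrow>\<^sub>0 real)" where
  "std_basis i \<equiv> Poly_Mapping.single i 1"

definition prime_cyclotomic_polytope :: "nat \<Rightarrow> (nat \<Rightarrow>\<^sub>0 real) set" where
  "prime_cyclotomic_polytope p =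
     convex hull (insert (- (\<Sum>i<p - 1. std_basis i)) (std_basis ` {..<p - 1}))"

definition zeta :: "nat \<Rightarrow> complex" where
  "zeta n = exp (2 * of_real pi * \<i> / of_nat n)"

text \<open>
  \<open>represents p \<alpha> x z\<close>: the coordinates of \<open>z\<close> with respect to the \<open>\<int>\<close>-basis
  \<open>\<zeta>\<^bsup>k + j p^(\<alpha>-1)\<^esup>\<close> of \<open>\<int>[\<zeta>]\<close>, where \<open>\<zeta> = zeta (p ^ \<alpha>)\<close>, are those of \<open>x\<close>; the basis element
  with indices \<open>k\<close> and \<open>j\<close> goes to coordinate \<open>k (p - 1) + j\<close>.
\<close>

definition represents :: "nat \<Rightarrow> nat \<Rightarrow> (nat \<Rightarrow>\<^sub>0 real) \<Rightarrow> complex \<Rightarrow> bool" where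
  "represents p \<alpha> x z \<longleftrightarrow>
     lattice_point (totient (p ^ \<alpha>)) x \<and>
     (\<Sum>k<p ^ (\<alpha> - 1). \<Sum>j<p - 1.
        of_real (Poly_Mapping.lookup x (k * (p - 1) + j)) *
        zeta (p ^ \<alpha>) ^ (k + j * p ^ (\<alpha> - 1))) = z"

definition prime_power_cyclotomic_polytope :: "nat \<Rightarrow> nat \<Rightarrow> (nat \<Rightarrow>\<^sub>0 real) set" where
  "prime_power_cyclotomic_polytope p \<alpha> =
     convex hull {x. \<exists>a::nat. represents p \<alpha> x (zeta (p ^ \<alpha>) ^ a)}"

text \<open>
  \<open>\<real>\<^sup>k \<otimes> \<real>\<^sup>n\<close> is identified with \<open>\<real>\<^bsup>k n\<^esup>\<close> by sending \<open>e\<^sub>i \<otimes> e\<^sub>j\<close> to \<open>e\<^bsub>i n + j\<^esub>\<close> (Kronecker product). The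
  parameter \<open>n\<close> is the dimension of the space containing the second factor.
\<close>

definition tensor_vec :: "nat \<Rightarrow> (nat \<Rightarrow>\<^sub>0 real) \<Rightarrow> (nat \<Rightarrow>\<^sub>0 real) \<Rightarrow> (nat \<Rightarrow>\<^sub>0 real)" where
  "tensor_vec n v w =
     (\<Sum>i\<in>Poly_Mapping.keys v. \<Sum>j\<in>Poly_Mapping.keys w.
        Poly_Mapping.single (i * n + j) (Poly_Mapping.lookup v i * Poly_Mapping.lookup w j))"

definition tensor_polytope ::
    "nat \<Rightarrow> (nat \<Rightarrow>\<^sub>0 real) set \<Rightarrow> (nat \<Rightarrow>\<^sub>0 real) set \<Rightarrow> (nat \<Rightarrow>\<^sub>0 real) set" where
  "tensor_polytope n P Q =
     convex hull {tensor_vec n v w |v w. v extreme_point_of P \<and> w extreme_point_of Q}"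

text \<open>
  \<open>\<C>\<^sub>m\<close> is defined only up to a permutation of the coordinates, because \<open>m\<close> may be split into coprime
  factors in several ways. Hence a relation: \<open>cyclotomic_polytope m P\<close> says that \<open>P\<close> arises as \<open>\<C>\<^sub>m\<close>
  from some choice of the successive splittings.
\<close>

inductive cyclotomic_polytope :: "nat \<Rightarrow> (nat \<Rightarrow>\<^sub>0 real) set \<Rightarrow> bool" where
  prime: "prime p \<Longrightarrow> cyclotomic_polytope p (prime_cyclotomic_polytope p)"
| prime_power: "prime p \<Longrightarrow> \<alpha> \<ge> 2 \<Longrightarrow>
    cyclotomic_polytope (p ^ \<alpha>) (prime_power_cyclotomic_polytope p \<alpha>)"
| coprime: "m\<^sub>1 > 1 \<Longrightarrow> m\<^sub>2 > 1 \<Longrightarrow> coprime m\<^sub>1 m\<^sub>2 \<Longrightarrow>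
    cyclotomic_polytope m\<^sub>1 P \<Longrightarrow> cyclotomic_polytope m\<^sub>2 Q \<Longrightarrow>
    cyclotomic_polytope (m\<^sub>1 * m\<^sub>2) (tensor_polytope (totient m\<^sub>2) P Q)"

lemma cyclotomic_polytope_exists:
  "m > 1 \<Longrightarrow> \<exists>P. cyclotomic_polytope m P"
proof (induction m rule: less_induct)
  case (less m)
  obtain p where p: "prime p" "p dvd m"
    using less.prems prime_factor_nat[of m] by auto
  define \<alpha> where "\<alpha> = multiplicity p m"
  obtain r where r: "m = p ^ \<alpha> * r" "\<not> p dvd r"
    using multiplicity_decompose'[of m p] p less.prems
    by (metis \<alpha>_def bot_nat_0.not_eq_extremum not_one_less_zero not_prime_unit)
  have \<alpha>: "\<alpha> \<ge> 1"
    using r p by (cases "\<alpha> = 0") auto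
  have pp: "\<exists>P. cyclotomic_polytope (p ^ \<alpha>) P"
  proof (cases "\<alpha> = 1")
    case True
    then show ?thesis using cyclotomic_polytope.prime[OF p(1)] by auto
  next
    case False
    then have "\<alpha> \<ge> 2" using \<alpha> by linarith
    then show ?thesis using cyclotomic_polytope.prime_power[OF p(1)] by blast
  qed
  have gt: "p ^ \<alpha> > 1"
    using one_less_power[OF prime_gt_1_nat[OF p(1)]] \<alpha> by simp
  show ?case
  proof (cases "r = 1")
    case True
    then show ?thesis using pp r by simp
  next
    case False
    have "r \<noteq> 0" using r less.prems by (metis mult_0_right not_one_less_zero)
    then have r1: "r > 1" using False by simp
    have "r < m" using r gt r1 by simp
    then obtain Q where Q: "cyclotomic_polytope r Q" using less.IH r1 by blast
    have "coprime (p ^ \<alpha>) r"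
      using p(1) r(2) by (simp add: prime_imp_coprime)
    then show ?thesis
      using pp Q gt r1 r(1) cyclotomic_polytope.coprime by blast
  qed
qed

end

theory Submission
  imports
    Defs
    "HOL-Library.Nat_Bijection"
    "HOL-Analysis.Complex_Transcendental"
    "Jordan_Normal_Form.Char_Poly"
begin

text \<open>
  Up to sign, each vertex of \<open>\<C>\<^sub>m\<close> is the indicator vector of a class of one of several partitions of
  the coordinates. A power of 2 contributes only the discrete partition, a power of an odd prime the
  discrete partition and one more, and tensor products multiply partitions. For two odd primes this
  gives the discrete partition and three others \<open>\<rho>, \<sigma>, \<tau>\<close>, with \<open>\<tau>\<close> coarser than \<open>\<sigma>\<close>. Any set of
  classes can then be signed so that the signed sum of the indicator vectors has entries \<open>0, \<plusminus>1\<close>: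
  classes of \<open>\<tau>\<close> get \<open>+\<close>, classes of \<open>\<rho>\<close> get \<open>-\<close>, a class of \<open>\<sigma>\<close> gets \<open>-\<close> if the class of \<open>\<tau>\<close> around it
  is in the set and \<open>+\<close> otherwise, and singletons are used to correct single coordinates. By the
  criterion of Ghouila-Houri the matrix of the vertices is totally unimodular. A lattice point of the
  polytope is a combination of linearly independent vertices with coefficients of sum at most 1;
  unimodularity makes the coefficients integral, so the point is a vertex or the origin.

  That the coordinates of the powers of \<open>\<zeta>\<close> are the expected ones needs the irreducibility of the
  prime power cyclotomic polynomials, which follows from Eisenstein's criterion.
\<close>

section \<open>The criterion of Ghouila-Houri\<close>

text \<open>Ghouila-Houri's condition, with rows and columns exchanged so that it speaks of sets of
  vertices.\<close>

definition signable_mat :: "real mat \<Rightarrow> bool" where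
  "signable_mat A \<longleftrightarrow> (\<forall>J\<subseteq>{..<dim_col A}. \<exists>s. (\<forall>j\<in>J. s j \<in> {1, -1}) \<and>
     (\<forall>i<dim_row A. (\<Sum>j\<in>J. s j * A $$ (i, j)) \<in> {0, 1, -1}))"

text \<open>Signs are pulled back along \<open>g\<close>, whose injectivity turns a sum over
  \<open>J\<close> into one over its image. This serves \<open>mat_delete\<close> and
  \<open>submatrix\<close> alike.\<close>

lemma signable_mat_reindex:
  assumes A: "signable_mat A"
    and f: "\<And>i. i < n \<Longrightarrow> f i < dim_row A"
    and g: "\<And>j. j < k \<Longrightarrow> g j < dim_col A" "inj_on g {..<k}"
  shows "signable_mat (Matrix.mat n k (\<lambda>(i, j). A $$ (f i, g j)))"
  unfolding signable_mat_def
proof (intro allI impI)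
  fix J assume "J \<subseteq> {..<dim_col (Matrix.mat n k (\<lambda>(i, j). A $$ (f i, g j)))}"
  then have J: "J \<subseteq> {..<k}" by simp
  have "g ` J \<subseteq> {..<dim_col A}" using g(1) J by auto
  then obtain s where s: "\<forall>j\<in>g ` J. s j \<in> {1, -1}"
    "\<forall>i<dim_row A. (\<Sum>j\<in>g ` J. s j * A $$ (i, j)) \<in> {0, 1, -1}"
    using A unfolding signable_mat_def by blast
  have inj: "inj_on g J" using g(2) J by (rule inj_on_subset)
  show "\<exists>s. (\<forall>j\<in>J. s j \<in> {1, - 1}) \<and>
    (\<forall>i<dim_row (Matrix.mat n k (\<lambda>(i, j). A $$ (f i, g j))).
      (\<Sum>j\<in>J. s j * Matrix.mat n k (\<lambda>(i, j). A $$ (f i, g j)) $$ (i, j)) \<in> {0, 1, - 1})"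
  proof (intro exI[of _ "s \<circ> g"] conjI ballI allI impI)
    fix j assume "j \<in> J" then show "(s \<circ> g) j \<in> {1, -1}" using s(1) by auto
  next
    fix i assume "i < dim_row (Matrix.mat n k (\<lambda>(i, j). A $$ (f i, g j)))"
    then have i: "i < n" by simp
    have "(\<Sum>j\<in>J. (s \<circ> g) j * Matrix.mat n k (\<lambda>(i, j). A $$ (f i, g j)) $$ (i, j))
      = (\<Sum>j\<in>J. (s \<circ> g) j * A $$ (f i, g j))"
      using J i by (intro sum.cong) auto
    also have "\<dots> = (\<Sum>j\<in>g ` J. s j * A $$ (f i, j))"
      by (simp add: sum.reindex[OF inj])
    finally show "(\<Sum>j\<in>J. (s \<circ> g) j * Matrix.mat n k (\<lambda>(i, j). A $$ (f i, g j)) $$ (i, j))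
      \<in> {0, 1, - 1}" using s(2) f[OF i] by simp
  qed
qed

lemma signable_mat_entry:
  assumes "signable_mat A" "i < dim_row A" "j < dim_col A"
  shows "A $$ (i, j) \<in> {0, 1, -1}"
proof -
  have "{j} \<subseteq> {..<dim_col A}" using assms by auto
  then obtain s where "\<forall>j\<in>{j}. s j \<in> {1, -1}"
    "\<forall>i<dim_row A. (\<Sum>j\<in>{j}. s j * A $$ (i, j)) \<in> {0, 1, -1}"
    using assms(1) unfolding signable_mat_def by blast
  then have "s j \<in> {1, -1}" "s j * A $$ (i, j) \<in> {0, 1, -1}" using assms(2) by auto
  then show ?thesis by auto
qed

text \<open>
  A column of the adjugate has entries \<open>0, \<plusminus>1\<close> by
  induction; signing the columns in its support gives, by parity, a multiple of the same unit vector.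
\<close>

lemma det_signable_mat:
  assumes "A \<in> carrier_mat n n" "signable_mat A"
  shows "Determinant.det A \<in> {0, 1, -1}"
  using assms
proof (induction n arbitrary: A)
  case 0
  then show ?case by simp
next
  case (Suc n)
  note A = Suc.prems(1)
  \<comment> \<open>\<open>b\<close> is the column of the adjugate with A b = det(A) e_0; its
    entries are signed minors of \<open>A\<close> without row 0.\<close>
  define b where "b j = adj_mat A $$ (j, 0)" for j
  have b01: "b j \<in> {0, 1, -1}" if j: "j < Suc n" for j
  proof -
    have "signable_mat (mat_delete A 0 j)"
      unfolding mat_delete_def
      using A Suc.prems(2) j by (intro signable_mat_reindex) (auto simp: inj_on_def)
    then have "Determinant.det (mat_delete A 0 j) \<in> {0, 1, -1}"
      using A by (intro Suc.IH) (auto simp: mat_delete_def)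
    moreover have "(-1::real) ^ j \<in> {1, -1}" by (cases "even j") auto
    ultimately show ?thesis
      using A j by (auto simp: b_def adj_mat_def cofactor_def)
  qed
  have sum_b: "(\<Sum>j<Suc n. A $$ (i, j) * b j) = (if i = 0 then Determinant.det A else 0)"
    if i: "i < Suc n" for i
  proof -
    have "(A * adj_mat A) $$ (i, 0) = (\<Sum>j<Suc n. A $$ (i, j) * b j)"
      using A i adj_mat(1)[OF A] by (auto simp: b_def scalar_prod_def atLeast0LessThan intro!: sum.cong)
    moreover have "(A * adj_mat A) $$ (i, 0) = (if i = 0 then Determinant.det A else 0)"
      unfolding adj_mat(2)[OF A] using i by simp
    ultimately show ?thesis by (simp only:)
  qed
  define J where "J = {j. j < Suc n \<and> b j \<noteq> 0}"
  have "J \<subseteq> {..<dim_col A}" using A by (auto simp: J_def)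
  then have "\<exists>s. (\<forall>j\<in>J. s j \<in> {1, -1}) \<and> (\<forall>i<Suc n. (\<Sum>j\<in>J. s j * A $$ (i, j)) \<in> {0, 1, -1})"
    using Suc.prems(2) unfolding signable_mat_def carrier_matD(1)[OF A] by (elim allE impE)
  then obtain s where s: "\<And>j. j \<in> J \<Longrightarrow> s j \<in> {1, -1}"
    "\<And>i. i < Suc n \<Longrightarrow> (\<Sum>j\<in>J. s j * A $$ (i, j)) \<in> {0, 1, -1}"
    by blast
  define c where "c = (\<Sum>j\<in>J. s j * A $$ (0, j))"
  have J: "finite J" "J \<subseteq> {..<Suc n}" by (auto simp: J_def)
  have sum_b_J: "(\<Sum>j\<in>J. A $$ (i, j) * b j) = (if i = 0 then Determinant.det A else 0)"
    if i: "i < Suc n" for i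
  proof -
    have "(\<Sum>j\<in>J. A $$ (i, j) * b j) = (\<Sum>j<Suc n. A $$ (i, j) * b j)"
      by (intro sum.mono_neutral_left) (auto simp: J_def)
    then show ?thesis using sum_b[OF i] by simp
  qed
  have zero: "(\<Sum>j\<in>J. s j * A $$ (i, j)) = 0" if i: "i < Suc n" "i \<noteq> 0" for i
  proof -
    have "(\<Sum>j\<in>J. s j * A $$ (i, j)) = (\<Sum>j\<in>J. s j * A $$ (i, j)) - (\<Sum>j\<in>J. A $$ (i, j) * b j)"
      using sum_b_J i by simp
    \<comment> \<open>On \<open>J\<close> both \<open>s j\<close> and \<open>b j\<close> are odd, so
      the two sums are congruent mod 2. The second vanishes in this row, so the first is even, hence
      0.\<close>
    also have "\<dots> = 2 * (\<Sum>j\<in>J. A $$ (i, j) * ((s j - b j) / 2))"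
      unfolding sum_subtractf[symmetric] sum_distrib_left
      by (intro sum.cong refl) (simp add: field_simps)
    finally have eq: "(\<Sum>j\<in>J. s j * A $$ (i, j)) = 2 * (\<Sum>j\<in>J. A $$ (i, j) * ((s j - b j) / 2))" .
    have "(\<Sum>j\<in>J. A $$ (i, j) * ((s j - b j) / 2)) \<in> \<int>"
    proof (intro Ints_sum Ints_mult)
      fix j assume j: "j \<in> J"
      then have "j < Suc n" by (simp add: J_def)
      then show "A $$ (i, j) \<in> \<int>"
        using signable_mat_entry[OF Suc.prems(2), of i j] A i by auto
      show "(s j - b j) / 2 \<in> \<int>"
        using s(1)[OF j] b01[of j] j by (auto simp: J_def)
    qed
    then obtain z where "(\<Sum>j\<in>J. A $$ (i, j) * ((s j - b j) / 2)) = of_int z" by (auto elim: Ints_cases)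
    with eq have z: "(\<Sum>j\<in>J. s j * A $$ (i, j)) = of_int (2 * z)" by simp
    have "2 * z = 0 \<or> 2 * z = 1 \<or> 2 * z = -1"
      using s(2)[OF i(1)] unfolding z by (metis insertE empty_iff of_int_0 of_int_1 of_int_minus of_int_eq_iff)
    then have "z = 0" by presburger
    with z show ?thesis by simp
  qed
  show ?case
  proof (cases "J = {}")
    case True
    then show ?thesis using sum_b_J[of 0] by simp
  next
    case False
    then obtain l where l: "l \<in> J" by auto
    have "(adj_mat A * A) $$ (l, j) = (if j = l then Determinant.det A else 0)" if "j < Suc n" for j
      using adj_mat(3)[OF A] that l J by auto
    moreover have "(adj_mat A * A) $$ (l, j) = (\<Sum>i<Suc n. adj_mat A $$ (l, i) * A $$ (i, j))"
      if "j < Suc n" for j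
      using A that l J adj_mat(1)[OF A] by (auto simp: scalar_prod_def atLeast0LessThan intro!: sum.cong)
    ultimately have inv: "(\<Sum>i<Suc n. adj_mat A $$ (l, i) * A $$ (i, j)) = (if j = l then Determinant.det A else 0)"
      if "j < Suc n" for j using that by simp
    \<comment> \<open>The signed sum of the columns is c e_0. Row \<open>l\<close> of the adjugate
      turns this into det(A) s_l = b_l c, where s_l and b_l are signs.\<close>
    have "Determinant.det A * s l = (\<Sum>j\<in>J. s j * (if j = l then Determinant.det A else 0))"
      using J l by (simp add: if_distrib[of "(*) _"] sum.delta cong: if_cong)
    also have "\<dots> = (\<Sum>j\<in>J. s j * (\<Sum>i<Suc n. adj_mat A $$ (l, i) * A $$ (i, j)))"
    proof (intro sum.cong refl)
      fix j assume "j \<in> J"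
      then have "j < Suc n" by (simp add: J_def)
      then show "s j * (if j = l then Determinant.det A else 0)
          = s j * (\<Sum>i<Suc n. adj_mat A $$ (l, i) * A $$ (i, j))"
        by (simp only: inv)
    qed
    also have "\<dots> = (\<Sum>i<Suc n. adj_mat A $$ (l, i) * (\<Sum>j\<in>J. s j * A $$ (i, j)))"
      unfolding sum_distrib_left by (subst sum.swap) (simp only: mult.left_commute)
    also have "\<dots> = (\<Sum>i<Suc n. if i = 0 then b l * c else 0)"
      using zero by (intro sum.cong) (auto simp: b_def c_def)
    also have "\<dots> = b l * c" by simp
    finally show ?thesis
      using s(1)[OF l] s(2)[of 0] b01[of l] l by (auto simp: c_def J_def)
  qed
qed

text \<open>Reindexing along \<open>pick\<close> shows that every square submatrix inherits
  signability, so \<open>det_signable_mat\<close> applies to it.\<close>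

lemma totally_unimodular_if_signable:
  assumes "signable_mat A"
  shows "totally_unimodular A"
  unfolding totally_unimodular_def
proof (intro conjI allI impI)
  show "elements_mat A \<subseteq> {0, 1, -1}"
  proof
    fix a assume "a \<in> elements_mat A"
    then obtain i j where "i < dim_row A" "j < dim_col A" "a = A $$ (i, j)"
      by (blast dest: elements_matD)
    then show "a \<in> {0, 1, -1}" using signable_mat_entry[OF assms] by simp
  qed
next
  fix I J assume IJ: "I \<subseteq> {..<dim_row A} \<and> J \<subseteq> {..<dim_col A} \<and> card I = card J"
  have eq: "{i. i < dim_row A \<and> i \<in> I} = I" "{j. j < dim_col A \<and> j \<in> J} = J" using IJ by auto
  have "finite I" "finite J" using IJ finite_subset by blast+
  have "inj_on (pick J) {..<card J}"
  proof (rule linorder_inj_onI)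
    fix i j assume "i < j" "j \<in> {..<card J}"
    then have "pick J i < pick J j" by (intro pick_mono_le) simp_all
    then show "pick J i \<noteq> pick J j" by simp
  qed auto
  moreover have "pick J j < dim_col A" if "j < card J" for j
    using pick_in_set_le[OF that] IJ by auto
  moreover have "pick I i < dim_row A" if "i < card J" for i
    using pick_in_set_le[of i I] that IJ by auto
  ultimately have "signable_mat (submatrix A I J)"
    unfolding submatrix_def eq using IJ assms by (intro signable_mat_reindex) auto
  moreover have "submatrix A I J \<in> carrier_mat (card I) (card I)"
    unfolding carrier_mat_def mem_Collect_eq dim_submatrix eq using IJ by simp
  ultimately show "Determinant.det (submatrix A I J) \<in> {0, 1, -1}"
    by (rule det_signable_mat[rotated])
qed

text \<open>With alternating signs the partial sums alternate between \<open>g\<close> and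
  0.\<close>

lemma signs_with_sum:
  fixes g :: real
  assumes "finite J" "g \<in> {1, -1}"
  shows "\<exists>u. (\<forall>j\<in>J. u j \<in> {1, -1}) \<and> (\<Sum>j\<in>J. u j) = (if odd (card J) then g else 0)"
  using assms
proof (induction J rule: finite_induct)
  case empty
  then show ?case by simp
next
  case (insert a J)
  then obtain u where u: "\<forall>j\<in>J. u j \<in> {1, -1}" "(\<Sum>j\<in>J. u j) = (if odd (card J) then g else 0)"
    by auto
  have "(\<Sum>j\<in>J. (u(a := if odd (card J) then -g else g)) j) = (\<Sum>j\<in>J. u j)"
    using insert.hyps by (intro sum.cong) auto
  then show ?case
    using insert u by (intro exI[of _ "u(a := if odd (card J) then -g else g)"]) auto
qed

text \<open>
  Columns that agree up to sign can be cancelled in pairs, so repetitions of a vector \<open>f k\<close>, its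
  negative and the zero vector are allowed among the columns.
\<close>

lemma signable_mat_of_family:
  fixes f :: "'k \<Rightarrow> nat \<Rightarrow> real"
  assumes family: "\<And>K. finite K \<Longrightarrow> \<exists>g. (\<forall>k. g k \<in> {1, -1}) \<and>
      (\<forall>i<dim_row A. (\<Sum>k\<in>K. g k * f k i) \<in> {0, 1, -1})"
    and col: "\<And>j. j < dim_col A \<Longrightarrow> e j \<in> {0, 1, -1}"
      "\<And>i j. i < dim_row A \<Longrightarrow> j < dim_col A \<Longrightarrow> A $$ (i, j) = e j * f (a j) i"
  shows "signable_mat A"
  unfolding signable_mat_def
proof (intro allI impI)
  fix J assume J: "J \<subseteq> {..<dim_col A}"
  then have "finite J" using finite_subset by blast
  define J' where "J' = {j \<in> J. e j \<noteq> 0}"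
  have fin: "finite J'" using \<open>finite J\<close> by (simp add: J'_def)
  \<comment> \<open>Vectors with an even number of copies will cancel; each of the others leaves one
    signed copy of \<open>f k\<close>.\<close>
  define K where "K = {k \<in> a ` J'. odd (card {j \<in> J'. a j = k})}"
  have "finite K" using fin by (simp add: K_def)
  then obtain g where g: "\<forall>k. g k \<in> {1, -1}"
    "\<forall>i<dim_row A. (\<Sum>k\<in>K. g k * f k i) \<in> {0, 1, -1}"
    using family by blast
  have "\<forall>k. \<exists>u. (\<forall>j\<in>{j \<in> J'. a j = k}. u j \<in> {1, -1}) \<and>
      (\<Sum>j | j \<in> J' \<and> a j = k. u j) = (if odd (card {j \<in> J'. a j = k}) then g k else 0)"
    using fin g(1) by (intro allI signs_with_sum) auto
  from choice[OF this] obtain u where u: "\<forall>k. (\<forall>j\<in>{j \<in> J'. a j = k}. u k j \<in> {1, -1}) \<and>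
      (\<Sum>j | j \<in> J' \<and> a j = k. u k j) = (if odd (card {j \<in> J'. a j = k}) then g k else 0)" ..
  have u_sign: "u (a j) j \<in> {1, -1}" if "j \<in> J'" for j
    using u[THEN spec, THEN conjunct1, THEN bspec, of j "a j"] that by simp
  note u_sum = u[THEN spec, THEN conjunct2]
  \<comment> \<open>The factor \<open>e j\<close> undoes the sign of the column; zero columns get
    the arbitrary sign 1.\<close>
  define s where "s j = (if j \<in> J' then e j * u (a j) j else 1)" for j
  have e: "e j \<in> {1, -1}" if "j \<in> J'" for j
    using col(1)[of j] that J by (auto simp: J'_def)
  show "\<exists>s. (\<forall>j\<in>J. s j \<in> {1, - 1}) \<and> (\<forall>i<dim_row A. (\<Sum>j\<in>J. s j * A $$ (i, j)) \<in> {0, 1, - 1})"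
  proof (intro exI[of _ s] conjI ballI allI impI)
    fix j
    show "s j \<in> {1, -1}"
      using e[of j] u_sign[of j] by (auto simp: s_def)
  next
    fix i assume i: "i < dim_row A"
    have "(\<Sum>j\<in>J. s j * A $$ (i, j)) = (\<Sum>j\<in>J'. u (a j) j * f (a j) i)"
    proof (intro sum.mono_neutral_cong_right ballI)
      show "s j * A $$ (i, j) = u (a j) j * f (a j) i" if "j \<in> J'" for j
        using col(2)[OF i, of j] e[OF that] that J by (auto simp: s_def J'_def)
      show "s j * A $$ (i, j) = 0" if "j \<in> J - J'" for j
        using col(2)[OF i, of j] that J by (auto simp: J'_def)
    qed (use \<open>finite J\<close> in \<open>auto simp: J'_def\<close>)
    also have "\<dots> = (\<Sum>k\<in>a ` J'. \<Sum>j | j \<in> J' \<and> a j = k. u (a j) j * f (a j) i)"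
      by (rule sum.image_gen[OF fin])
    also have "\<dots> = (\<Sum>k\<in>a ` J'. (\<Sum>j | j \<in> J' \<and> a j = k. u k j) * f k i)"
      unfolding sum_distrib_right by (intro sum.cong) auto
    also have "\<dots> = (\<Sum>k\<in>K. g k * f k i)"
      unfolding u_sum using fin by (intro sum.mono_neutral_cong_right) (auto simp: K_def)
    finally show "(\<Sum>j\<in>J. s j * A $$ (i, j)) \<in> {0, 1, - 1}" using g(2) i by simp
  qed
qed

section \<open>Signed indicator vectors of partition classes\<close>

text \<open>A partition is represented by a function whose fibres are its classes.\<close>

definition class_vectors :: "nat \<Rightarrow> (nat \<Rightarrow> nat) set \<Rightarrow> (nat \<Rightarrow>\<^sub>0 real) set" where
  "class_vectors n F = {x. \<exists>\<pi>\<in>F. \<exists>k. \<exists>\<epsilon>\<in>{1, -1}.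
     \<forall>i. Poly_Mapping.lookup x i = (if i < n \<and> \<pi> i = k then \<epsilon> else 0)}"

text \<open>
  The condition satisfied by the family of partitions when the index has the given number of odd prime
  factors; nothing is claimed for more than two of them.
\<close>

fun level :: "nat \<Rightarrow> (nat \<Rightarrow> nat) set \<Rightarrow> bool" where
  "level 0 F \<longleftrightarrow> (\<exists>\<iota>. inj \<iota> \<and> F \<subseteq> {\<iota>})"
| "level (Suc 0) F \<longleftrightarrow> (\<exists>\<iota> \<beta>. inj \<iota> \<and> F \<subseteq> {\<iota>, \<beta>})"
| "level (Suc (Suc 0)) F \<longleftrightarrow>
     (\<exists>\<iota> \<rho> \<sigma> \<tau>. inj \<iota> \<and> (\<forall>i j. \<sigma> i = \<sigma> j \<longrightarrow> \<tau> i = \<tau> j) \<and> F \<subseteq> {\<iota>, \<rho>, \<sigma>, \<tau>})"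
| "level (Suc (Suc (Suc _))) F \<longleftrightarrow> True"

text \<open>The pair \<open>(t, k)\<close> names the class of \<open>P t\<close> with value
  \<open>k\<close>, and \<open>P 0\<close> to \<open>P 3\<close> stand for \<open>\<iota>\<close>,
  \<open>\<rho>\<close>, \<open>\<sigma>\<close>, \<open>\<tau>\<close>. A coordinate lies in one
  class of each partition, so at most four nonzero summands meet there.\<close>

lemma class_signs:
  fixes P :: "nat \<Rightarrow> nat \<Rightarrow> nat"
  assumes inj: "inj (P 0)" and coarse: "\<And>i j. P 2 i = P 2 j \<Longrightarrow> P 3 i = P 3 j"
    and K: "finite K"
  shows "\<exists>g. (\<forall>k. g k \<in> {1, -1}) \<and>
    (\<forall>i. (\<Sum>k\<in>K. g k * (if fst k < 4 \<and> P (fst k) i = snd k then 1 else 0)) \<in> {0, 1, -1 :: real})"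
proof -
  \<comment> \<open>\<open>h\<close> sends a class of \<open>P 2\<close> to the class of
    \<open>P 3\<close> around it; by \<open>coarse\<close> the chosen representative does not
    matter.\<close>
  define h where "h k = P 3 (SOME i. P 2 i = k)" for k
  have h: "h (P 2 i) = P 3 i" for i
    unfolding h_def by (rule coarse) (rule someI, rule refl)
  define s :: "nat \<Rightarrow> real" where "s k = (if (3, h k) \<in> K then -1 else 1)" for k
  define w :: "nat \<Rightarrow> real" where "w i = (if (3, P 3 i) \<in> K then 1 else 0)
     - (if (1, P 1 i) \<in> K then 1 else 0) + (if (2, P 2 i) \<in> K then s (P 2 i) else 0)" for i
  \<comment> \<open>\<open>P 3\<close> and \<open>P 2\<close> together contribute 0 or 1: next to a
    selected class of \<open>P 3\<close> the sign \<open>s\<close> makes \<open>P 2\<close>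
    subtract, otherwise add. \<open>P 1\<close> then subtracts 0 or 1.\<close>
  have w: "w i \<in> {0, 1, -1}" for i by (simp add: w_def s_def h)
  \<comment> \<open>A class of \<open>P 0\<close> contains at most one coordinate, recovered by
    \<open>the_inv\<close>, so its sign can be fitted to the value of \<open>w\<close>
    there.\<close>
  define g :: "nat \<times> nat \<Rightarrow> real" where "g = (\<lambda>(t, k). if t = 0 then (if w (the_inv (P 0) k) = 1 then -1 else 1)
    else if t = 1 then -1 else if t = 2 then s k else 1)"
  show ?thesis
  proof (intro exI[of _ g] conjI allI)
    show "g k \<in> {1, -1}" for k by (auto simp: g_def s_def split: prod.splits)
    fix i
    let ?T = "{t. t < 4 \<and> (t, P t i) \<in> K}"
    have "(\<Sum>k\<in>K. g k * (if fst k < 4 \<and> P (fst k) i = snd k then 1 else 0)) = (\<Sum>k\<in>(\<lambda>t. (t, P t i)) ` ?T. g k)"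
      using K by (intro sum.mono_neutral_cong_right) auto
    also have "\<dots> = (\<Sum>t\<in>?T. g (t, P t i))"
      by (subst sum.reindex) (auto simp: inj_on_def)
    also have "\<dots> = (\<Sum>t<4. if (t, P t i) \<in> K then g (t, P t i) else 0)"
      by (intro sum.mono_neutral_cong_left) auto
    also have "\<dots> = (if (0, P 0 i) \<in> K then g (0, P 0 i) else 0) + w i"
      by (simp add: eval_nat_numeral g_def w_def)
    also have "g (0, P 0 i) = (if w i = 1 then -1 else 1)"
      by (simp add: g_def the_inv_f_f[OF inj])
    finally show "(\<Sum>k\<in>K. g k * (if fst k < 4 \<and> P (fst k) i = snd k then 1 else 0)) \<in> {0, 1, -1}"
      using w[of i] by auto
  qed
qed

lemma signable_mat_class_vectors:
  assumes F: "F \<subseteq> {\<iota>, \<rho>, \<sigma>, \<tau>}" "inj \<iota>" "\<And>i j. \<sigma> i = \<sigma> j \<Longrightarrow> \<tau> i = \<tau> j"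
    and xs: "set xs \<subseteq> insert 0 (class_vectors n F)"
  shows "signable_mat (Matrix.mat n (length xs) (\<lambda>(i, j). Poly_Mapping.lookup (xs ! j) i))"
proof -
  define P where "P t = (if t = 0 then \<iota> else if t = 1 then \<rho> else if t = 2 then \<sigma> else \<tau>)" for t :: nat
  have P: "\<exists>t<4. \<pi> = P t" if "\<pi> \<in> F" for \<pi>
  proof -
    have "\<pi> = P 0 \<or> \<pi> = P 1 \<or> \<pi> = P 2 \<or> \<pi> = P 3" using that F(1) by (auto simp: P_def)
    then show ?thesis by (metis zero_less_numeral one_less_numeral_iff numeral_less_iff
      semiring_norm(76,78,79,77,81))
  qed
  define f :: "nat \<times> nat \<Rightarrow> nat \<Rightarrow> real"
    where "f k i = (if fst k < 4 \<and> P (fst k) i = snd k then 1 else 0)" for k i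
  have "\<forall>j\<in>{..<length xs}. \<exists>q. fst q \<in> {0, 1, -1} \<and> (\<forall>i<n. Poly_Mapping.lookup (xs ! j) i = fst q * f (snd q) i)"
  proof
    fix j assume "j \<in> {..<length xs}"
    then have j: "j < length xs" by simp
    show "\<exists>q. fst q \<in> {0, 1, -1} \<and> (\<forall>i<n. Poly_Mapping.lookup (xs ! j) i = fst q * f (snd q) i)"
    proof (cases "xs ! j = 0")
      case True
      then show ?thesis by (intro exI[of _ "(0, undefined)"]) simp
    next
      case False
      then have "xs ! j \<in> class_vectors n F" using subsetD[OF xs nth_mem[OF j]] by simp
      then obtain \<pi> k \<epsilon> where *: "\<pi> \<in> F" "\<epsilon> \<in> {1, -1}"
        "\<forall>i. Poly_Mapping.lookup (xs ! j) i = (if i < n \<and> \<pi> i = k then \<epsilon> else 0)"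
        unfolding class_vectors_def by blast
      then obtain t where "t < 4" "\<pi> = P t" using P by blast
      with * show ?thesis by (intro exI[of _ "(\<epsilon>, (t, k))"]) (auto simp: f_def)
    qed
  qed
  from bchoice[OF this] obtain q where q: "\<forall>j\<in>{..<length xs}. fst (q j) \<in> {0, 1, -1} \<and>
      (\<forall>i<n. Poly_Mapping.lookup (xs ! j) i = fst (q j) * f (snd (q j)) i)" ..
  have "\<exists>g. (\<forall>k. g k \<in> {1, -1}) \<and> (\<forall>i. (\<Sum>k\<in>K. g k * f k i) \<in> {0, 1, -1})" if "finite K" for K
    unfolding f_def
  proof (rule class_signs[OF _ _ that])
    show "inj (P 0)" using F(2) by (simp add: P_def)
    show "P 3 i = P 3 j" if "P 2 i = P 2 j" for i j
      using F(3)[of i j] that by (simp add: P_def)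
  qed
  note family = this
  show ?thesis
  proof (rule signable_mat_of_family[where f = f and e = "\<lambda>j. fst (q j)" and a = "\<lambda>j. snd (q j)"], goal_cases)
    case (1 K)
    from family[OF 1] obtain g where "\<forall>k. g k \<in> {1, -1}" "\<forall>i. (\<Sum>k\<in>K. g k * f k i) \<in> {0, 1, -1}"
      by (elim exE conjE)
    then show ?case by (intro exI[of _ g]) simp
  next
    case (2 j)
    then show ?case using q by simp
  next
    case (3 i j)
    then show ?case using q by simp
  qed
qed

section \<open>Lattice points\<close>

lemma lookup_scaleR [simp]:
  "Poly_Mapping.lookup (r *\<^sub>R x) i = r *\<^sub>R Poly_Mapping.lookup x i"
  for x :: "'a \<Rightarrow>\<^sub>0 'b::real_vector"
proof -
  have "finite {i. r *\<^sub>R Poly_Mapping.lookup x i \<noteq> 0}"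
    by (rule finite_subset[OF _ finite_keys[of x]]) (auto simp: in_keys_iff)
  then show ?thesis by (simp add: scaleR_poly_mapping_def)
qed

text \<open>
  As in Caratheodory's theorem, but with linear instead of affine independence, at the price of
  coefficients that sum to at most 1: the linear dependency is oriented so that removing it does not
  increase the sum.
\<close>

lemma convex_hull_independent_sum:
  fixes x :: "'a::real_vector"
  assumes "x \<in> convex hull W"
  obtains X u where "finite X" "X \<subseteq> W" "independent X" "\<And>v. v \<in> X \<Longrightarrow> 0 \<le> u v"
    "sum u X \<le> 1" "(\<Sum>v\<in>X. u v *\<^sub>R v) = x"
proof -
  define Q where "Q X u \<longleftrightarrow> finite X \<and> X \<subseteq> W \<and> (\<forall>v\<in>X. 0 \<le> u v) \<and> sum u X \<le> 1 \<and>
    (\<Sum>v\<in>X. u v *\<^sub>R v) = x" for X :: "'a set" and u :: "'a \<Rightarrow> real"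
  have "\<exists>k. \<exists>X u. Q X u \<and> card X = k"
    using assms unfolding convex_hull_explicit Q_def by fastforce
  then obtain X u where Q: "Q X u" and min: "card X = (LEAST k. \<exists>X u. Q X u \<and> card X = k)"
    using LeastI_ex[of "\<lambda>k. \<exists>X u. Q X u \<and> card X = k"] by blast
  have minimal: "card X \<le> card Y" if "Q Y w" for Y w
    unfolding min using that by (intro Least_le) blast
  have "independent X"
  proof
    assume "dependent X"
    moreover have "finite X" using Q by (simp add: Q_def)
    ultimately obtain c0 where c0: "\<exists>v\<in>X. c0 v \<noteq> 0" "(\<Sum>v\<in>X. c0 v *\<^sub>R v) = 0"
      by (auto simp: real_vector.dependent_finite)
    define c where "c v = (if sum c0 X \<ge> 0 then c0 v else - c0 v)" for v
    have c: "\<exists>v\<in>X. c v \<noteq> 0" "(\<Sum>v\<in>X. c v *\<^sub>R v) = 0" "sum c X \<ge> 0"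
      using c0 by (cases "sum c0 X \<ge> 0"; simp add: c_def sum_negf)+
    define Y where "Y = {v \<in> X. c v > 0}"
    have fin: "finite X" "finite Y" using Q by (auto simp: Q_def Y_def)
    have "Y \<noteq> {}"
    proof
      assume "Y = {}"
      then have le: "\<And>v. v \<in> X \<Longrightarrow> 0 \<le> - c v" by (force simp: Y_def)
      moreover have "(\<Sum>v\<in>X. - c v) = 0"
        using sum_nonneg[of X "\<lambda>v. - c v"] le c(3) by (simp add: sum_negf)
      ultimately have "\<forall>v\<in>X. - c v = 0"
        using sum_nonneg_eq_0_iff[of X "\<lambda>v. - c v"] fin(1) by blast
      with c(1) show False by simp
    qed
    define t where "t = Min ((\<lambda>v. u v / c v) ` Y)"
    have "t \<in> (\<lambda>v. u v / c v) ` Y" unfolding t_def using fin \<open>Y \<noteq> {}\<close> by (intro Min_in) auto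
    then obtain a where a: "a \<in> Y" "t = u a / c a" by blast
    have t: "t * c v \<le> u v" if "v \<in> Y" for v
    proof -
      have "t \<le> u v / c v" unfolding t_def using fin that by (intro Min_le) auto
      then show ?thesis using that by (simp add: Y_def field_simps)
    qed
    have "t \<ge> 0" using a Q by (auto simp: Y_def Q_def)
    define w where "w v = u v - t * c v" for v
    have wa: "w a = 0" using a by (simp add: w_def Y_def)
    have "Q (X - {a}) w"
      unfolding Q_def
    proof (intro conjI ballI)
      fix v assume "v \<in> X - {a}"
      then have "v \<in> X" by simp
      show "0 \<le> w v"
      proof (cases "v \<in> Y")
        case True
        then show ?thesis using t by (simp add: w_def)
      next
        case False
        then have "t * c v \<le> 0" using \<open>v \<in> X\<close> \<open>t \<ge> 0\<close> by (auto simp: Y_def mult_nonneg_nonpos)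
        moreover have "0 \<le> u v" using Q \<open>v \<in> X\<close> by (simp add: Q_def)
        ultimately show ?thesis by (simp add: w_def)
      qed
    next
      have "sum w (X - {a}) = sum w X"
        using fin wa by (intro sum.mono_neutral_left) auto
      also have "\<dots> = sum u X - t * sum c X" by (simp add: w_def sum_subtractf sum_distrib_left)
      also have "\<dots> \<le> sum u X" using c(3) \<open>t \<ge> 0\<close> by simp
      also have "\<dots> \<le> 1" using Q by (simp add: Q_def)
      finally show "sum w (X - {a}) \<le> 1" .
      have "(\<Sum>v\<in>X - {a}. w v *\<^sub>R v) = (\<Sum>v\<in>X. w v *\<^sub>R v)"
        using fin wa by (intro sum.mono_neutral_left) auto
      also have "\<dots> = (\<Sum>v\<in>X. u v *\<^sub>R v) - t *\<^sub>R (\<Sum>v\<in>X. c v *\<^sub>R v)"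
        by (simp add: w_def scaleR_left_diff_distrib sum_subtractf scaleR_sum_right)
      also have "\<dots> = x" using Q c(2) by (simp add: Q_def)
      finally show "(\<Sum>v\<in>X - {a}. w v *\<^sub>R v) = x" .
    qed (use Q in \<open>auto simp: Q_def\<close>)
    from minimal[OF this] show False
      using a fin card_Diff1_less[of X a] by (simp add: Y_def)
  qed
  then show thesis using that[of X u] Q by (auto simp: Q_def)
qed

text \<open>Lists serve as ordered families of columns, so that one hypothesis covers every basis
  chosen from \<open>V\<close>.\<close>

definition signable_set :: "nat \<Rightarrow> (nat \<Rightarrow>\<^sub>0 real) set \<Rightarrow> bool" where
  "signable_set n V \<longleftrightarrow> (\<forall>xs. set xs \<subseteq> V \<longrightarrow>
     signable_mat (Matrix.mat n (length xs) (\<lambda>(i, j). Poly_Mapping.lookup (xs ! j) i)))"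

section \<open>Integral coordinates in a unimodular basis\<close>

lemma std_basis_sum:
  assumes "Poly_Mapping.keys x \<subseteq> {..<n}"
  shows "(\<Sum>i<n. Poly_Mapping.lookup x i *\<^sub>R std_basis i) = x"
  using assms
  by (intro poly_mapping_eqI)
    (auto simp: lookup_sum lookup_single when_def in_keys_iff if_distrib[of "(*) _"] cong: if_cong)

lemma inj_std_basis: "inj_on (std_basis :: nat \<Rightarrow> _) A"
  by (auto simp: inj_on_def) (metis lookup_single_eq lookup_single_not_eq zero_neq_one)

lemma independent_std_basis: "independent (std_basis ` {..<n})"
proof
  assume "dependent (std_basis ` {..<n})"
  then obtain u where u: "\<exists>v\<in>std_basis ` {..<n}. u v \<noteq> 0" "(\<Sum>v\<in>std_basis ` {..<n}. u v *\<^sub>R v) = 0"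
    by (auto simp: real_vector.dependent_finite)
  then have "(\<Sum>i<n. u (std_basis i) *\<^sub>R std_basis i) = 0"
    by (simp add: sum.reindex[OF inj_std_basis])
  then have "Poly_Mapping.lookup (\<Sum>i<n. u (std_basis i) *\<^sub>R std_basis i) i = 0" for i by simp
  moreover have "Poly_Mapping.lookup (\<Sum>i<n. u (std_basis i) *\<^sub>R std_basis i) i = u (std_basis i)"
    if "i < n" for i
    using that by (simp add: lookup_sum lookup_single when_def if_distrib[of "(*) _"] cong: if_cong)
  ultimately have "i < n \<Longrightarrow> u (std_basis i) = 0" for i by simp
  with u(1) show False by auto
qed

lemma card_std_basis: "card (std_basis ` {..<n}) = n"
  by (simp add: card_image inj_std_basis)

lemma adj_mat_signable_entry:
  assumes "A \<in> carrier_mat n n" "signable_mat A" "i < n" "j < n"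
  shows "adj_mat A $$ (i, j) \<in> {0, 1, -1}"
proof -
  obtain k where n: "n = Suc k" using assms(3) by (cases n) auto
  have "signable_mat (mat_delete A j i)"
    unfolding mat_delete_def
    using assms by (intro signable_mat_reindex) (auto simp: inj_on_def)
  then have "Determinant.det (mat_delete A j i) \<in> {0, 1, -1}"
    using assms(1) by (intro det_signable_mat[of _ k]) (auto simp: mat_delete_def n)
  moreover have "(-1::real) ^ (j + i) \<in> {1, -1}" by (cases "even (j + i)") auto
  ultimately show ?thesis
    using assms by (auto simp: adj_mat_def cofactor_def)
qed

text \<open>Standard basis vectors extend \<open>X\<close> to a basis \<open>B\<close> of the whole
  space inside \<open>V\<close>. Its matrix has determinant 1 or -1, so its inverse is integral, and
  so are the coordinates of an integral vector.\<close>

lemma integral_coefficients: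
  assumes V: "signable_set n V" "std_basis ` {..<n} \<subseteq> V" "\<And>v. v \<in> V \<Longrightarrow> Poly_Mapping.keys v \<subseteq> {..<n}"
    and X: "finite X" "X \<subseteq> V" "independent X"
    and x: "(\<Sum>v\<in>X. u v *\<^sub>R v) = x" "\<And>i. Poly_Mapping.lookup x i \<in> \<int>"
    and v: "v \<in> X"
  shows "u v \<in> \<int>"
proof -
  let ?E = "std_basis ` {..<n}"
  have "X \<subseteq> X \<union> ?E" by simp
  then obtain B where B: "X \<subseteq> B" "B \<subseteq> X \<union> ?E" "independent B" "X \<union> ?E \<subseteq> span B"
    using X(3) by (rule real_vector.maximal_independent_subset_extend)
  have finB: "finite B" using B(2) X(1) by (auto intro: finite_subset)
  have BV: "B \<subseteq> V" using B(2) X(2) V(2) by blast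
  have "B \<subseteq> span ?E"
  proof
    fix b assume "b \<in> B"
    then have "Poly_Mapping.keys b \<subseteq> {..<n}" using BV V(3) by blast
    then have "b = (\<Sum>i<n. Poly_Mapping.lookup b i *\<^sub>R std_basis i)" by (rule std_basis_sum[symmetric])
    also have "\<dots> \<in> span ?E" by (intro span_sum span_scale span_base) auto
    finally show "b \<in> span ?E" .
  qed
  then have "card B \<le> card ?E"
    using real_vector.independent_span_bound[of ?E B] B(3) by simp
  moreover have "card ?E \<le> card B"
    using real_vector.independent_span_bound[OF finB independent_std_basis[of n]] B(4) by simp
  ultimately have cardB: "card B = n" by (simp add: card_std_basis)
  obtain ys where ys: "set ys = B" "distinct ys" using finite_distinct_list[OF finB] by blast
  have len: "length ys = n" using ys cardB distinct_card by fastforce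
  have bij: "bij_betw ((!) ys) {..<n} B" using bij_betw_nth[OF ys(2)] ys(1) len by simp
  define A where "A = Matrix.mat n n (\<lambda>(i, j). Poly_Mapping.lookup (ys ! j) i)"
  have A: "A \<in> carrier_mat n n" by (simp add: A_def)
  have sA: "signable_mat A" using V(1) ys(1) BV unfolding signable_set_def A_def len[symmetric] by blast
  have "Determinant.det A \<noteq> 0"
  proof
    assume "Determinant.det A = 0"
    \<comment> \<open>A kernel vector would be a linear dependency of \<open>B\<close>, since all
      coordinates from \<open>n\<close> on vanish on \<open>V\<close>.\<close>
    then obtain w where w: "w \<in> carrier_vec n" "w \<noteq> 0\<^sub>v n" "A *\<^sub>v w = 0\<^sub>v n"
      using det_0_iff_vec_prod_zero_field[OF A] by blast
    define c where "c b = vec_index w (the_inv_into {..<n} ((!) ys) b)" for b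
    have c: "c (ys ! j) = vec_index w j" if "j < n" for j
      unfolding c_def using bij that by (subst the_inv_into_f_f) (auto simp: bij_betw_def)
    have "(\<Sum>b\<in>B. c b *\<^sub>R b) = (\<Sum>j<n. vec_index w j *\<^sub>R ys ! j)"
      using c by (simp add: sum.reindex_bij_betw[OF bij, symmetric])
    also have "\<dots> = 0"
    proof (rule poly_mapping_eqI)
      fix i
      show "Poly_Mapping.lookup (\<Sum>j<n. vec_index w j *\<^sub>R ys ! j) i = Poly_Mapping.lookup 0 i"
      proof (cases "i < n")
        case True
        then have "vec_index (A *\<^sub>v w) i = 0" using w(3) by simp
        moreover have "vec_index (A *\<^sub>v w) i = (\<Sum>j<n. Poly_Mapping.lookup (ys ! j) i * vec_index w j)"
          using True w(1) A by (auto simp: A_def scalar_prod_def atLeast0LessThan intro!: sum.cong)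
        ultimately show ?thesis by (simp add: lookup_sum mult.commute)
      next
        case False
        have "Poly_Mapping.lookup (ys ! j) i = 0" if "j < n" for j
        proof -
          have "ys ! j \<in> V" using BV ys(1) len that nth_mem[of j ys] by blast
          then have "i \<notin> Poly_Mapping.keys (ys ! j)" using V(3) False by blast
          then show ?thesis by (simp add: in_keys_iff)
        qed
        then show ?thesis by (simp add: lookup_sum)
      qed
    qed
    finally have "(\<Sum>b\<in>B. c b *\<^sub>R b) = 0" .
    then have "\<forall>b\<in>B. c b = 0"
      using B(3) real_vector.dependent_finite[OF finB] by blast
    then have "vec_index w j = 0" if "j < n" for j
      using c[OF that] ys(1) len that nth_mem[of j ys] by auto
    with w(1,2) show False by (auto intro!: eq_vecI)
  qed
  with det_signable_mat[OF A sA] have det: "Determinant.det A \<in> {1, -1}" by simp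
  define c where "c b = (if b \<in> X then u b else 0)" for b
  have "x = (\<Sum>b\<in>B. c b *\<^sub>R b)"
    unfolding x(1)[symmetric] using finB B(1) by (intro sum.mono_neutral_cong_left) (auto simp: c_def)
  also have "\<dots> = (\<Sum>j<n. c (ys ! j) *\<^sub>R ys ! j)"
    by (simp add: sum.reindex_bij_betw[OF bij, symmetric])
  finally have lx: "Poly_Mapping.lookup x i = (\<Sum>j<n. A $$ (i, j) * c (ys ! j))" if "i < n" for i
    using that by (simp add: lookup_sum A_def mult.commute)
  have "v \<in> set ys" using v B(1) ys(1) by blast
  then obtain l where l: "l < n" "ys ! l = v" using len by (auto simp: in_set_conv_nth)
  have inv: "(\<Sum>i<n. adj_mat A $$ (l, i) * A $$ (i, j)) = (if j = l then Determinant.det A else 0)"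
    if j: "j < n" for j
  proof -
    have "(adj_mat A * A) $$ (l, j) = (\<Sum>i<n. adj_mat A $$ (l, i) * A $$ (i, j))"
      using A j l adj_mat(1)[OF A] by (auto simp: scalar_prod_def atLeast0LessThan intro!: sum.cong)
    moreover have "(adj_mat A * A) $$ (l, j) = (if j = l then Determinant.det A else 0)"
      unfolding adj_mat(3)[OF A] using j l by simp
    ultimately show ?thesis by (simp only:)
  qed
  \<comment> \<open>As in Cramer's rule, row \<open>l\<close> of the adjugate isolates the
    coefficient of \<open>v\<close>.\<close>
  have "(\<Sum>i<n. adj_mat A $$ (l, i) * Poly_Mapping.lookup x i)
      = (\<Sum>i<n. \<Sum>j<n. adj_mat A $$ (l, i) * A $$ (i, j) * c (ys ! j))"
    by (intro sum.cong refl) (simp add: lx sum_distrib_left mult.assoc)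
  also have "\<dots> = (\<Sum>j<n. (\<Sum>i<n. adj_mat A $$ (l, i) * A $$ (i, j)) * c (ys ! j))"
    unfolding sum_distrib_right by (rule sum.swap)
  also have "\<dots> = (\<Sum>j<n. if j = l then Determinant.det A * c (ys ! j) else 0)"
    by (intro sum.cong refl) (simp add: inv)
  also have "\<dots> = Determinant.det A * u v" using l v by (simp add: c_def)
  finally have eq: "Determinant.det A * u v = (\<Sum>i<n. adj_mat A $$ (l, i) * Poly_Mapping.lookup x i)" by simp
  have "(\<Sum>i<n. adj_mat A $$ (l, i) * Poly_Mapping.lookup x i) \<in> \<int>"
  proof (intro Ints_sum Ints_mult x(2))
    fix i assume "i \<in> {..<n}"
    then show "adj_mat A $$ (l, i) \<in> \<int>" using adj_mat_signable_entry[OF A sA l(1), of i] by auto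
  qed
  then have "Determinant.det A * u v \<in> \<int>" unfolding eq .
  then show ?thesis using det by (auto simp: minus_in_Ints_iff)
qed

text \<open>Nonnegative integers of sum at most 1 are all zero, which gives the origin, or a single
  1 among zeros, which gives an element of \<open>W\<close>.\<close>

lemma lattice_points_convex_hull:
  assumes V: "signable_set n V" "std_basis ` {..<n} \<subseteq> V" "\<And>v. v \<in> V \<Longrightarrow> Poly_Mapping.keys v \<subseteq> {..<n}"
    and W: "W \<subseteq> V" and x: "x \<in> convex hull W" "lattice_point n x"
  shows "x \<in> insert 0 W"
proof -
  obtain X u where X: "finite X" "X \<subseteq> W" "independent X" and u: "\<And>v. v \<in> X \<Longrightarrow> 0 \<le> u v"
    "sum u X \<le> 1" "(\<Sum>v\<in>X. u v *\<^sub>R v) = x"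
    using convex_hull_independent_sum[OF x(1)] by blast
  have int: "u v \<in> \<int>" if "v \<in> X" for v
    using integral_coefficients[OF V X(1) _ X(3) u(3) _ that] X(2) W x(2)
    unfolding lattice_point_def by blast
  show ?thesis
  proof (cases "\<forall>v\<in>X. u v = 0")
    case True
    then show ?thesis using u(3) by simp
  next
    case False
    then obtain a where a: "a \<in> X" "u a \<noteq> 0" by blast
    have "u a \<ge> 1" using int[OF a(1)] u(1)[OF a(1)] a(2) by (auto elim!: Ints_cases)
    have split: "sum u X = u a + sum u (X - {a})" using X(1) a(1) by (rule sum.remove)
    have nonneg: "0 \<le> sum u (X - {a})" using u(1) by (intro sum_nonneg) auto
    then have "u a = 1" "sum u (X - {a}) = 0" using split u(2) \<open>u a \<ge> 1\<close> by linarith+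
    then have "\<forall>v\<in>X - {a}. u v = 0"
      using sum_nonneg_eq_0_iff[of "X - {a}" u] X(1) u(1) by auto
    then have "(\<Sum>v\<in>X. u v *\<^sub>R v) = a"
      using X(1) a(1) \<open>u a = 1\<close> by (simp add: sum.remove[of X a])
    then show ?thesis using u(3) X(2) a(1) by auto
  qed
qed

section \<open>Powers of a primitive root of unity\<close>

lemma of_nat_prime_dvd_binomial_power:
  fixes a b :: "'a :: comm_ring_1"
  assumes "prime p"
  shows "of_nat p dvd (a + b) ^ p - (a ^ p + b ^ p)"
proof -
  have p: "p > 0" using assms by (simp add: prime_gt_0_nat)
  let ?t = "\<lambda>k. of_nat (p choose k) * a ^ k * b ^ (p - k)"
  have "(a + b) ^ p = (\<Sum>k\<le>p. ?t k)" by (rule binomial_ring)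
  also have "{..p} = insert 0 (insert p {1..<p})" using p by auto
  also have "(\<Sum>k\<in>\<dots>. ?t k) = b ^ p + (a ^ p + (\<Sum>k\<in>{1..<p}. ?t k))" using p by simp
  finally have "(a + b) ^ p - (a ^ p + b ^ p) = (\<Sum>k\<in>{1..<p}. ?t k)" by simp
  moreover have "of_nat p dvd ?t k" if "k \<in> {1..<p}" for k
  proof -
    have "p dvd (p choose k)" using that p assms by (intro dvd_choose_prime) auto
    then have "(of_nat p :: 'a) dvd of_nat (p choose k)" by (auto elim!: dvdE)
    then show ?thesis by (simp add: dvd_mult2)
  qed
  ultimately show ?thesis by (metis (no_types, lifting) dvd_sum)
qed

text \<open>The congruence for \<open>k\<close> is raised to the power \<open>p\<close>, using that
  x - y divides x^p - y^p. A general commutative ring is taken so that integer polynomials are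
  covered.\<close>

lemma of_nat_prime_dvd_binomial_prime_power:
  fixes a b :: "'a :: comm_ring_1"
  assumes "prime p"
  shows "of_nat p dvd (a + b) ^ (p ^ k) - (a ^ (p ^ k) + b ^ (p ^ k))"
proof (induction k)
  case 0
  then show ?case by simp
next
  case (Suc k)
  let ?x = "(a + b) ^ (p ^ k)" and ?y = "a ^ (p ^ k) + b ^ (p ^ k)"
  have "of_nat p dvd ?x ^ p - ?y ^ p"
    unfolding power_diff_sumr2 using Suc by (rule dvd_mult2)
  moreover have "of_nat p dvd ?y ^ p - ((a ^ (p ^ k)) ^ p + (b ^ (p ^ k)) ^ p)"
    by (rule of_nat_prime_dvd_binomial_power[OF assms])
  ultimately have "of_nat p dvd (?x ^ p - ?y ^ p) + (?y ^ p - ((a ^ (p ^ k)) ^ p + (b ^ (p ^ k)) ^ p))"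
    by (rule dvd_add)
  then have "of_nat p dvd ?x ^ p - ((a ^ (p ^ k)) ^ p + (b ^ (p ^ k)) ^ p)"
    by (simp only: add_diff_eq diff_add_cancel)
  then show ?case unfolding power_Suc2 power_mult .
qed

text \<open>By induction all terms of \<open>coeff (F * G) i\<close> except
  \<open>coeff F i * coeff G 0\<close> are divisible by \<open>p\<close>, hence this one is
  too.\<close>

lemma prime_dvd_coeff_factor:
  fixes F G :: "int poly"
  assumes "prime p" "\<not> p dvd coeff G 0" "\<And>i. i < n \<Longrightarrow> p dvd coeff (F * G) i" "i < n"
  shows "p dvd coeff F i"
  using assms(4)
proof (induction i rule: less_induct)
  case (less i)
  have "coeff (F * G) i = (\<Sum>k<i. coeff F k * coeff G (i - k)) + coeff F i * coeff G 0"
    by (simp add: coeff_mult lessThan_Suc_atMost[symmetric])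
  moreover have "p dvd (\<Sum>k<i. coeff F k * coeff G (i - k))"
    using less by (intro dvd_sum dvd_mult2) auto
  moreover have "p dvd coeff (F * G) i" using assms(3) less.prems .
  ultimately have "p dvd coeff F i * coeff G 0" by (metis dvd_add_right_iff)
  then show ?case using assms(1,2) by (simp add: prime_dvd_mult_iff)
qed

text \<open>Some factor has a constant term prime to \<open>p\<close>. If the other had smaller
  degree than the product, \<open>p\<close> would divide its leading coefficient; so it has the full
  degree.\<close>

lemma eisenstein:
  fixes F G :: "int poly"
  assumes p: "prime p" and low: "\<And>i. i < degree (F * G) \<Longrightarrow> p dvd coeff (F * G) i"
    and lead: "\<not> p dvd lead_coeff (F * G)" and const: "\<not> p ^ 2 dvd coeff (F * G) 0"
  shows "degree F = 0 \<or> degree G = 0"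
proof -
  have nz: "F \<noteq> 0" "G \<noteq> 0" using lead by auto
  have deg: "degree (F * G) = degree F + degree G" using nz by (rule degree_mult_eq)
  have "\<not> (p dvd coeff F 0 \<and> p dvd coeff G 0)"
    using const by (auto simp: coeff_mult_0 power2_eq_square intro: mult_dvd_mono)
  then consider "\<not> p dvd coeff G 0" | "\<not> p dvd coeff F 0" by blast
  then show ?thesis
  proof cases
    case 1
    have "\<not> degree F < degree (F * G)"
    proof
      assume "degree F < degree (F * G)"
      then have "p dvd lead_coeff F" using prime_dvd_coeff_factor[OF p 1 low] by blast
      then show False using lead by (simp add: lead_coeff_mult)
    qed
    then show ?thesis using deg by simp
  next
    case 2
    have "\<not> degree G < degree (F * G)"
    proof
      assume "degree G < degree (F * G)"
      then have "p dvd lead_coeff G"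
        using prime_dvd_coeff_factor[OF p 2, of "degree (F * G)" G] low by (simp add: mult.commute)
      then show False using lead by (simp add: lead_coeff_mult)
    qed
    then show ?thesis using deg by simp
  qed
qed

text \<open>This is the cyclotomic polynomial of index \<open>q p\<close> when \<open>q\<close> is a power of the prime \<open>p\<close>.\<close>

definition prime_power_cyclotomic_poly :: "nat \<Rightarrow> nat \<Rightarrow> int poly" where
  "prime_power_cyclotomic_poly p q = (\<Sum>j<p. monom 1 q ^ j)"

lemma degree_monom_minus_one:
  assumes "n > 0"
  shows "degree (monom 1 n - 1 :: int poly) = n" "lead_coeff (monom 1 n - 1 :: int poly) = 1"
    "monom 1 n - 1 \<noteq> (0 :: int poly)"
proof -
  have c: "coeff (monom 1 n - 1 :: int poly) n = 1" using assms by (simp add: coeff_1)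
  show deg: "degree (monom 1 n - 1 :: int poly) = n"
  proof (rule antisym)
    show "degree (monom 1 n - 1 :: int poly) \<le> n"
      using assms by (intro degree_le) (auto simp: coeff_1)
    show "n \<le> degree (monom 1 n - 1 :: int poly)" using c by (intro le_degree) simp
  qed
  show "lead_coeff (monom 1 n - 1 :: int poly) = 1" using c deg by simp
  show "monom 1 n - 1 \<noteq> (0 :: int poly)" using c by (metis coeff_0 zero_neq_one)
qed

lemma prime_power_cyclotomic_poly_mult:
  "(monom 1 q - 1) * prime_power_cyclotomic_poly p q = monom 1 (q * p) - 1"
  unfolding prime_power_cyclotomic_poly_def power_diff_1_eq[symmetric]
  by (simp add: monom_power)

lemma degree_prime_power_cyclotomic_poly:
  assumes "p > 0" "q > 0"
  shows "degree (prime_power_cyclotomic_poly p q) = q * (p - 1)"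
    "lead_coeff (prime_power_cyclotomic_poly p q) = 1"
proof -
  let ?f = "prime_power_cyclotomic_poly p q"
  have qp: "q * p > 0" using assms by simp
  note m = prime_power_cyclotomic_poly_mult[of q p]
  have nz: "?f \<noteq> 0" "monom 1 q - 1 \<noteq> (0 :: int poly)"
    using degree_monom_minus_one(3)[OF qp] degree_monom_minus_one(3)[OF assms(2)] unfolding m[symmetric] by auto
  have "q + degree ?f = q * p"
    using degree_mult_eq[OF nz(2,1)] unfolding m degree_monom_minus_one(1)[OF qp] degree_monom_minus_one(1)[OF assms(2)] by simp
  then show "degree ?f = q * (p - 1)" by (simp add: diff_mult_distrib2)
  show "lead_coeff ?f = 1"
    using lead_coeff_mult[of "monom 1 q - 1" ?f]
    unfolding m degree_monom_minus_one(2)[OF qp] degree_monom_minus_one(2)[OF assms(2)] by simp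
qed

text \<open>Let q = p^s. In ((X+1)^q - 1) H = (X+1)^(qp) - 1 both powers of X+1 are binomials modulo
  p, which leaves X^q H congruent to X^(qp). The constant term is the value at 0, a sum of p
  ones.\<close>

lemma shifted_prime_power_cyclotomic_poly:
  fixes p s :: nat
  assumes p: "prime p"
  defines "H \<equiv> pcompose (prime_power_cyclotomic_poly p (p ^ s)) [:1, 1:]"
  shows "degree H = p ^ s * (p - 1)" "lead_coeff H = 1" "coeff H 0 = int p"
    "\<And>i. i < degree H \<Longrightarrow> int p dvd coeff H i"
proof -
  let ?q = "p ^ s" and ?L = "[:1, 1:] :: int poly"
  have pos: "p > 0" "?q > 0" using prime_gt_0_nat[OF p] by auto
  show deg: "degree H = ?q * (p - 1)"
    unfolding H_def degree_pcompose degree_prime_power_cyclotomic_poly(1)[OF pos] by simp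
  show "lead_coeff H = 1"
    unfolding H_def by (subst lead_coeff_comp) (simp_all add: degree_prime_power_cyclotomic_poly(2)[OF pos])
  have H: "H = (\<Sum>j<p. (?L ^ ?q) ^ j)"
    unfolding poly_eq_poly_eq_iff[symmetric] H_def prime_power_cyclotomic_poly_def
    by (rule ext) (simp add: poly_pcompose poly_sum poly_monom)
  show "coeff H 0 = int p"
    unfolding poly_0_coeff_0[symmetric] H by (simp add: poly_sum)
  have L: "of_nat p dvd ?L ^ (p ^ k) - (monom 1 (p ^ k) + 1)" for k
  proof -
    have "?L = [:0, 1:] + 1" by (simp add: one_pCons)
    then show ?thesis
      using of_nat_prime_dvd_binomial_prime_power[OF p, of "[:0, 1:] :: int poly" 1 k] by (simp add: monom_altdef)
  qed
  have "(?L ^ ?q - 1) * H = ?L ^ (?q * p) - 1"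
    unfolding H power_diff_1_eq[symmetric] by (simp add: power_mult)
  then have "monom 1 ?q * H - monom 1 (?q * p)
      = (?L ^ (p ^ Suc s) - (monom 1 (p ^ Suc s) + 1)) - (?L ^ ?q - (monom 1 ?q + 1)) * H"
    by (simp add: algebra_simps)
  also have "of_nat p dvd \<dots>" by (intro dvd_diff dvd_mult2 L)
  finally have "[:int p:] dvd monom 1 ?q * H - monom 1 (?q * p)" by (simp add: of_nat_poly)
  then have dvd: "int p dvd coeff (monom 1 ?q * H - monom 1 (?q * p)) i" for i
    by (simp add: const_poly_dvd_iff)
  fix i assume "i < degree H"
  then have i: "i < ?q * (p - 1)" by (simp add: deg)
  \<comment> \<open>Coefficient i of \<open>H\<close> is coefficient i + q of X^q H, and i + q lies
    below the exponent qp.\<close>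
  then have "i + ?q \<noteq> ?q * p" using pos by (simp add: diff_mult_distrib2)
  then show "int p dvd coeff H i" using dvd[of "i + ?q"] by (simp add: coeff_monom_mult)
qed

lemma zeta_power_eq_1_iff:
  assumes "n \<ge> 1"
  shows "zeta n ^ k = 1 \<longleftrightarrow> n dvd k"
proof -
  have "zeta n ^ k = exp (2 * of_real pi * \<i> * of_nat k / of_nat n)"
    by (simp add: zeta_def exp_of_nat_mult[symmetric] mult.commute)
  then show ?thesis using complex_root_unity_eq_1[OF assms] by simp
qed

text \<open>The \<open>q\<close>-th power of \<open>zeta (q * p)\<close> is a \<open>p\<close>-th
  root of unity other than 1, so its geometric sum vanishes.\<close>

lemma zeta_sum:
  assumes "p > 1" "q > 0"
  shows "(\<Sum>j<p. (zeta (q * p) ^ q) ^ j) = 0"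
proof -
  let ?z = "zeta (q * p) ^ q"
  have qp: "q * p \<ge> 1" using assms by (simp add: Suc_le_eq)
  have "?z \<noteq> 1" unfolding zeta_power_eq_1_iff[OF qp] using assms by (auto dest: dvd_imp_le)
  moreover have "(?z - 1) * (\<Sum>j<p. ?z ^ j) = 0"
    unfolding power_diff_1_eq[symmetric] using zeta_power_eq_1_iff[OF qp, of "q * p"] by (simp add: power_mult)
  ultimately show ?thesis by simp
qed

abbreviation int_poly_eval :: "int poly \<Rightarrow> complex \<Rightarrow> complex" where
  "int_poly_eval f \<equiv> poly (map_poly of_int f)"

text \<open>
  By Gauss's lemma, a primitive annihilator of minimal degree divides the cyclotomic polynomial over
  the integers; after substituting \<open>X + 1\<close>, Eisenstein's criterion shows that it has full degree.
\<close>

lemma degree_annihilator_zeta: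
  assumes p: "prime p" and f: "f \<noteq> 0" "int_poly_eval f (zeta (p ^ s * p)) = 0"
  shows "p ^ s * (p - 1) \<le> degree f"
proof (rule ccontr)
  let ?z = "zeta (p ^ s * p)" and ?q = "p ^ s"
  let ?\<Phi> = "prime_power_cyclotomic_poly p ?q"
  assume less: "\<not> ?q * (p - 1) \<le> degree f"
  have pos: "p > 0" "?q > 0" using prime_gt_0_nat[OF p] by auto
  have "\<exists>g. (g \<noteq> 0 \<and> int_poly_eval g ?z = 0) \<and> (\<forall>h. h \<noteq> 0 \<and> int_poly_eval h ?z = 0 \<longrightarrow> degree g \<le> degree h)"
    by (rule ex_has_least_nat[of _ f]) (use f in simp)
  then obtain g0 where g0: "g0 \<noteq> 0" "int_poly_eval g0 ?z = 0"
    and min: "\<And>h. h \<noteq> 0 \<Longrightarrow> int_poly_eval h ?z = 0 \<Longrightarrow> degree g0 \<le> degree h"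
    by blast
  define g where "g = primitive_part g0"
  have g: "g \<noteq> 0" "content g = 1" "degree g = degree g0" using g0 by (simp_all add: g_def)
  have "int_poly_eval (smult (content g0) g) ?z = of_int (content g0) * int_poly_eval g ?z"
    by (simp add: of_int_hom.map_poly_hom_smult)
  then have "int_poly_eval g0 ?z = of_int (content g0) * int_poly_eval g ?z" by (simp add: g_def)
  then have eg: "int_poly_eval g ?z = 0" using g0 by simp
  \<comment> \<open>Pseudo-division keeps the coefficients integral; its remainder annihilates the
    root as well and so vanishes by minimality of the degree.\<close>
  obtain a h where a: "a \<noteq> 0" "smult a ?\<Phi> = g * h + pseudo_mod ?\<Phi> g"
    using pseudo_mod(1)[OF g(1), of ?\<Phi>] by blast
  have e\<Phi>: "int_poly_eval ?\<Phi> ?z = 0"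
    unfolding prime_power_cyclotomic_poly_def
    using zeta_sum[of p ?q] pos prime_gt_1_nat[OF p] by (simp add: of_int_poly_hom.hom_sum of_int_poly_hom.hom_power poly_sum poly_monom)
  have "int_poly_eval (smult a ?\<Phi>) ?z = 0"
    using e\<Phi> by (simp add: of_int_hom.map_poly_hom_smult)
  then have "int_poly_eval (pseudo_mod ?\<Phi> g) ?z = 0"
    unfolding a(2) using eg by (simp add: of_int_poly_hom.hom_add of_int_poly_hom.hom_mult)
  then have "pseudo_mod ?\<Phi> g = 0"
    using min[of "pseudo_mod ?\<Phi> g"] pseudo_mod(2)[OF g(1), of ?\<Phi>] g(3) by fastforce
  then have ah: "smult a ?\<Phi> = g * h" using a(2) by simp
  have "content ?\<Phi> dvd 1"
    using content_dvd_coeff[of ?\<Phi> "degree ?\<Phi>"] degree_prime_power_cyclotomic_poly(2)[OF pos] by simp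
  then have "content ?\<Phi> = 1" by (simp only: is_unit_content_iff)
  then have "content h = \<bar>a\<bar>" using arg_cong[OF ah, of content] g(2) by (simp add: content_mult)
  \<comment> \<open>\<open>?\<Phi>\<close> is monic, hence primitive, so \<open>h\<close> has
    content |a|. The factor \<open>sgn a\<close> supplies the sign, and \<open>a\<close> can be
    cancelled.\<close>
  define h' where "h' = smult (sgn a) (primitive_part h)"
  have "smult a ?\<Phi> = g * smult \<bar>a\<bar> (primitive_part h)"
    unfolding ah using content_times_primitive_part[of h] \<open>content h = \<bar>a\<bar>\<close> by simp
  also have "\<dots> = smult a (g * h')" by (simp add: h'_def mult_sgn_abs abs_sgn)
  finally have \<Phi>: "?\<Phi> = g * h'" using a(1) by (metis smult_cancel)
  let ?F = "pcompose g [:1, 1:]" and ?G = "pcompose h' [:1, 1:]"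
  note H = shifted_prime_power_cyclotomic_poly[OF p, where s = s, unfolded \<Phi> pcompose_mult]
  have "\<not> int p ^ 2 dvd int p"
    using prime_gt_1_nat[OF p] zdvd_imp_le[of "int p ^ 2" "int p"] by (auto simp: power2_eq_square)
  then have "degree ?F = 0 \<or> degree ?G = 0"
    using H p prime_gt_1_nat[OF p] by (intro eisenstein[of "int p"]) auto
  \<comment> \<open>A nonzero constant \<open>g\<close> has no root; a constant \<open>h'\<close>
    would give \<open>g\<close> the full degree, more than that of \<open>f\<close>, against
    minimality.\<close>
  then show False
  proof
    assume "degree ?F = 0"
    then obtain c where "g = [:c:]" by (auto simp: degree_pcompose elim: degree_eq_zeroE)
    then show False using eg g(1) by simp
  next
    assume "degree ?G = 0"
    then have "degree h' = 0" by (simp add: degree_pcompose)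
    moreover have "h' \<noteq> 0" using H(2) by auto
    ultimately have "degree ?\<Phi> = degree g" unfolding \<Phi> using g(1) by (simp add: degree_mult_eq)
    then show False
      using degree_prime_power_cyclotomic_poly(1)[OF pos] min[OF f] g(3) less by simp
  qed
qed


section \<open>Coordinates of the powers of a root of unity\<close>

lemma digits_eq_iff:
  fixes k k' j j' q :: nat
  assumes "k < q" "k' < q"
  shows "k + j * q = k' + j' * q \<longleftrightarrow> k = k' \<and> j = j'"
proof
  assume eq: "k + j * q = k' + j' * q"
  have "(k + j * q) mod q = k" "(k' + j' * q) mod q = k'" using assms by simp_all
  moreover have "(k + j * q) div q = j" "(k' + j' * q) div q = j'" using assms by simp_all
  ultimately show "k = k' \<and> j = j'" using eq by metis
qed simp

lemma digits_less:
  fixes k j q r :: nat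
  assumes "k < q" "j < r"
  shows "k + j * q < q * r"
proof -
  have "k + j * q < Suc j * q" using assms by simp
  also have "\<dots> \<le> r * q" using assms by (intro mult_le_mono1) simp
  finally show ?thesis by (simp add: mult.commute)
qed

text \<open>The exponents are distinct and below p^s (p - 1), so the combination is the value of an
  integer polynomial of too small a degree to annihilate the root unless it is zero.\<close>

lemma int_combination_zeta_eq_0:
  assumes p: "prime p"
    and sum: "(\<Sum>k<p ^ s. \<Sum>j<p - 1. of_int (z k j) * zeta (p ^ s * p) ^ (k + j * p ^ s)) = 0"
    and kj: "k < p ^ s" "j < p - 1"
  shows "z k j = 0"
proof -
  let ?q = "p ^ s"
  define f :: "int poly" where "f = (\<Sum>k<?q. \<Sum>j<p - 1. monom (z k j) (k + j * ?q))"
  have coeff: "coeff f i = (\<Sum>k<?q. \<Sum>j<p - 1. if k + j * ?q = i then z k j else 0)" for i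
    by (simp add: f_def coeff_sum)
  have "int_poly_eval f (zeta (?q * p)) = 0"
    using sum by (simp add: f_def of_int_poly_hom.hom_sum poly_sum poly_monom)
  moreover have "coeff f i = 0" if "i \<ge> ?q * (p - 1)" for i
    unfolding coeff using that digits_less[of _ ?q _ "p - 1"] by (intro sum.neutral ballI) fastforce
  then have "f \<noteq> 0 \<Longrightarrow> \<not> ?q * (p - 1) \<le> degree f" using leading_coeff_neq_0 by blast
  ultimately have "f = 0" using degree_annihilator_zeta[OF p] by blast
  then have "0 = coeff f (k + j * ?q)" by simp
  also have "\<dots> = (\<Sum>k'<?q. \<Sum>j'<p - 1. if k' = k then if j' = j then z k j else 0 else 0)"
    unfolding coeff using digits_eq_iff[of _ ?q k _ j] kj by (intro sum.cong refl) auto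
  also have "\<dots> = (\<Sum>k'<?q. if k' = k then z k j else 0)"
    using kj by (intro sum.cong refl) simp
  also have "\<dots> = z k j" using kj by simp
  finally show ?thesis by simp
qed

lemma represents_unique:
  assumes p: "prime p" and \<alpha>: "\<alpha> \<ge> 1" and x: "represents p \<alpha> x w" and y: "represents p \<alpha> y w"
  shows "x = y"
proof (rule poly_mapping_eqI)
  fix i
  let ?s = "\<alpha> - 1" and ?x = "Poly_Mapping.lookup x" and ?y = "Poly_Mapping.lookup y"
  have n: "p ^ \<alpha> = p ^ ?s * p" using \<alpha> by (metis le_add_diff_inverse2 power_Suc2 Suc_eq_plus1)
  have tot: "totient (p ^ \<alpha>) = p ^ ?s * (p - 1)" using \<alpha> p by (simp add: totient_prime_power)
  \<comment> \<open>The coordinates are integral reals, so the floor only changes their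
    type.\<close>
  define z where "z k j = \<lfloor>?x (k * (p - 1) + j) - ?y (k * (p - 1) + j)\<rfloor>" for k j
  have int: "?x i - ?y i \<in> \<int>" for i
    using x y by (auto simp: represents_def lattice_point_def)
  have z: "of_int (z k j) = ?x (k * (p - 1) + j) - ?y (k * (p - 1) + j)" for k j
    unfolding z_def using int[of "k * (p - 1) + j"] by (auto elim!: Ints_cases)
  have zc: "(of_int (z k j) :: complex) = of_real (?x (k * (p - 1) + j)) - of_real (?y (k * (p - 1) + j))" for k j
    using arg_cong[OF z[of k j], of complex_of_real] by simp
  have sum: "(\<Sum>k<p ^ ?s. \<Sum>j<p - 1. of_int (z k j) * zeta (p ^ ?s * p) ^ (k + j * p ^ ?s)) = 0"
    using x y unfolding represents_def n[symmetric] zc left_diff_distrib sum_subtractf by simp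
  show "?x i = ?y i"
  proof (cases "i < totient (p ^ \<alpha>)")
    case True
    have p1: "p - 1 > 0" using prime_gt_1_nat[OF p] by simp
    have "i div (p - 1) < p ^ ?s" using True p1 unfolding tot by (simp add: div_less_iff_less_mult)
    moreover have "i mod (p - 1) < p - 1" using p1 by simp
    ultimately have "z (i div (p - 1)) (i mod (p - 1)) = 0"
      by (rule int_combination_zeta_eq_0[OF p sum])
    then show ?thesis using z[of "i div (p - 1)" "i mod (p - 1)"] unfolding div_mult_mod_eq by simp
  next
    case False
    then have "i \<notin> Poly_Mapping.keys x" "i \<notin> Poly_Mapping.keys y"
      using x y by (auto simp: represents_def lattice_point_def)
    then show ?thesis by (simp add: in_keys_iff)
  qed
qed

text \<open>Reduced modulo p^\<alpha>, the exponent is k + j q with q = p^(\<alpha>-1) and j < p.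
  For j < p - 1 this is a basis element. For j = p - 1, \<open>zeta_sum\<close> times \<zeta>^k
  expresses it as minus the sum of the basis elements with the same k, which occupy one block of p -
  1 consecutive coordinates.\<close>

lemma represents_root_power:
  assumes p: "prime p" and \<alpha>: "\<alpha> \<ge> 1" and x: "represents p \<alpha> x (zeta (p ^ \<alpha>) ^ a)"
  shows "(\<exists>i. i < totient (p ^ \<alpha>) \<and> x = std_basis i) \<or>
    (\<exists>k. \<forall>i. Poly_Mapping.lookup x i = (if i < totient (p ^ \<alpha>) \<and> i div (p - 1) = k then -1 else 0))"
proof -
  let ?q = "p ^ (\<alpha> - 1)" and ?r = "p - 1" and ?z = "zeta (p ^ \<alpha>)"
  have n: "p ^ \<alpha> = ?q * p" using \<alpha> by (metis le_add_diff_inverse2 power_Suc2 Suc_eq_plus1)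
  have tot: "totient (p ^ \<alpha>) = ?q * ?r" using \<alpha> p by (simp add: totient_prime_power)
  have pos: "p > 1" "?q > 0" "?r > 0" using prime_gt_1_nat[OF p] by auto
  have n1: "p ^ \<alpha> \<ge> 1" using pos by simp
  define k j where "k = a mod p ^ \<alpha> mod ?q" and "j = a mod p ^ \<alpha> div ?q"
  have k: "k < ?q" using pos by (simp add: k_def)
  have j: "j < p"
  proof -
    have "a mod p ^ \<alpha> < p ^ \<alpha>" using n1 by (intro mod_less_divisor) linarith
    also have "p ^ \<alpha> = p * ?q" unfolding n by (rule mult.commute)
    finally have "a mod p ^ \<alpha> < p * ?q" .
    then show ?thesis using pos by (simp add: j_def div_less_iff_less_mult)
  qed
  have "?z ^ a = ?z ^ (p ^ \<alpha> * (a div p ^ \<alpha>) + a mod p ^ \<alpha>)" by simp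
  also have "\<dots> = ?z ^ (a mod p ^ \<alpha>)"
    unfolding power_add power_mult using zeta_power_eq_1_iff[OF n1, of "p ^ \<alpha>"] by simp
  also have "a mod p ^ \<alpha> = k + j * ?q" unfolding k_def j_def by (rule mod_div_mult_eq[symmetric])
  finally have za: "?z ^ a = ?z ^ (k + j * ?q)" .
  show ?thesis
  proof (cases "j < ?r")
    case True
    let ?i = "k * ?r + j"
    have i: "?i < totient (p ^ \<alpha>)" using digits_less[OF True k] by (simp add: tot algebra_simps)
    have "(\<Sum>k'<?q. \<Sum>j'<?r. of_real (Poly_Mapping.lookup (std_basis ?i) (k' * ?r + j')) * ?z ^ (k' + j' * ?q))
      = (\<Sum>k'<?q. \<Sum>j'<?r. if k' = k then if j' = j then ?z ^ (k + j * ?q) else 0 else 0)"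
    proof (intro sum.cong refl)
      fix k' j' assume "j' \<in> {..<?r}"
      then have "j + k * ?r = j' + k' * ?r \<longleftrightarrow> j = j' \<and> k = k'"
        using True by (intro digits_eq_iff) auto
      then have eq: "?i = k' * ?r + j' \<longleftrightarrow> j = j' \<and> k = k'" by (simp only: add.commute)
      show "of_real (Poly_Mapping.lookup (std_basis ?i) (k' * ?r + j')) * ?z ^ (k' + j' * ?q)
          = (if k' = k then if j' = j then ?z ^ (k + j * ?q) else 0 else 0)"
        by (simp only: lookup_single when_def eq) auto
    qed
    also have "\<dots> = (\<Sum>k'<?q. if k' = k then ?z ^ (k + j * ?q) else 0)"
      using True by (intro sum.cong refl) simp
    also have "\<dots> = ?z ^ a" using k by (simp add: za)
    finally have "represents p \<alpha> (std_basis ?i) (?z ^ a)"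
      using i by (auto simp: represents_def lattice_point_def lookup_single when_def)
    then have "x = std_basis ?i" using represents_unique[OF p \<alpha> x] by simp
    with i show ?thesis by blast
  next
    case False
    then have jr: "j = ?r" using j by simp
    define y :: "nat \<Rightarrow>\<^sub>0 real" where "y = - (\<Sum>i | i < ?q * ?r \<and> i div ?r = k. std_basis i)"
    have y: "Poly_Mapping.lookup y i = (if i < totient (p ^ \<alpha>) \<and> i div ?r = k then -1 else 0)" for i
      by (simp add: y_def lookup_sum lookup_single when_def tot)
    have "Poly_Mapping.lookup y (k' * ?r + j') = (if k' = k then -1 else 0)" if "k' < ?q" "j' < ?r" for k' j'
    proof -
      have "k' * ?r + j' < ?q * ?r"
        using digits_less[OF that(2,1)] by (simp only: add.commute mult.commute)
      moreover have "(k' * ?r + j') div ?r = k'" using that(2) by simp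
      ultimately show ?thesis by (simp only: y tot) simp
    qed
    then have "(\<Sum>k'<?q. \<Sum>j'<?r. of_real (Poly_Mapping.lookup y (k' * ?r + j')) * ?z ^ (k' + j' * ?q))
      = (\<Sum>k'<?q. if k' = k then - (\<Sum>j'<?r. ?z ^ (k + j' * ?q)) else 0)"
      by (intro sum.cong refl) (simp add: sum_negf)
    also have "\<dots> = - (\<Sum>j'<?r. ?z ^ (k + j' * ?q))" using k by simp
    also have "\<dots> = ?z ^ a"
    proof -
      have "(\<Sum>j'<p. ?z ^ (k + j' * ?q)) = ?z ^ k * (\<Sum>j'<p. (?z ^ ?q) ^ j')"
        by (simp add: sum_distrib_left power_add power_mult[symmetric] mult.commute)
      also have "\<dots> = 0" using zeta_sum[OF pos(1,2)] by (simp add: n)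
      finally have "(\<Sum>j'<Suc ?r. ?z ^ (k + j' * ?q)) = 0" using pos by simp
      then show ?thesis unfolding za jr sum.lessThan_Suc by (simp add: add_eq_0_iff)
    qed
    finally have "represents p \<alpha> y (?z ^ a)"
      by (auto simp: represents_def lattice_point_def y in_keys_iff split: if_splits)
    then have "x = y" using represents_unique[OF p \<alpha> x] by simp
    with y show ?thesis by blast
  qed
qed

section \<open>Tensor products\<close>

text \<open>\<open>prod_encode\<close> turns pairs of class labels into numbers again, so that
  products can be iterated.\<close>

definition product_classes :: "nat \<Rightarrow> (nat \<Rightarrow> nat) \<Rightarrow> (nat \<Rightarrow> nat) \<Rightarrow> nat \<Rightarrow> nat" where
  "product_classes k \<pi> \<rho> i = prod_encode (\<pi> (i div k), \<rho> (i mod k))"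

lemma product_classes_eq_iff:
  "product_classes k \<pi> \<rho> i = product_classes k \<pi>' \<rho>' j \<longleftrightarrow>
     \<pi> (i div k) = \<pi>' (j div k) \<and> \<rho> (i mod k) = \<rho>' (j mod k)"
  by (simp add: product_classes_def)

lemma inj_product_classes:
  assumes "inj \<pi>" "inj \<rho>"
  shows "inj (product_classes k \<pi> \<rho>)"
proof (rule injI)
  fix i j assume "product_classes k \<pi> \<rho> i = product_classes k \<pi> \<rho> j"
  then have "i div k = j div k" "i mod k = j mod k"
    using assms by (simp_all add: product_classes_eq_iff inj_eq)
  then show "i = j" by (metis div_mult_mod_eq)
qed

definition product_family :: "nat \<Rightarrow> (nat \<Rightarrow> nat) set \<Rightarrow> (nat \<Rightarrow> nat) set \<Rightarrow> (nat \<Rightarrow> nat) set" where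
  "product_family k F G = {product_classes k \<pi> \<rho> | \<pi> \<rho>. \<pi> \<in> F \<and> \<rho> \<in> G}"

lemma level_2:
  "level 2 F \<longleftrightarrow>
     (\<exists>\<iota> \<rho> \<sigma> \<tau>. inj \<iota> \<and> (\<forall>i j. \<sigma> i = \<sigma> j \<longrightarrow> \<tau> i = \<tau> j) \<and> F \<subseteq> {\<iota>, \<rho>, \<sigma>, \<tau>})"
  unfolding numeral_2_eq_2 level.simps by (rule refl)

lemma product_family_subset:
  assumes "F \<subseteq> A" "G \<subseteq> B"
  shows "product_family k F G \<subseteq> (\<lambda>(\<pi>, \<rho>). product_classes k \<pi> \<rho>) ` (A \<times> B)"
  using assms unfolding product_family_def by fastforce

text \<open>The decisive case is 1 + 1: since \<open>\<iota>'\<close> is injective, the product of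
  \<open>\<beta>\<close> with \<open>\<iota>'\<close> refines that of \<open>\<beta>\<close> with
  \<open>\<beta>'\<close>, and these two become \<open>\<sigma>\<close> and \<open>\<tau>\<close>. A
  factor of level 0 preserves the given pattern.\<close>

lemma level_product_family:
  assumes "level a F" "level b G"
  shows "level (a + b) (product_family k F G)"
proof -
  let ?p = "product_classes k"
  consider "a = 0" "b = 0" | "a = 0" "b = 1" | "a = 1" "b = 0" | "a = 1" "b = 1"
    | "a = 0" "b = 2" | "a = 2" "b = 0" | "3 \<le> a + b"
    by linarith
  then show ?thesis
  proof cases
    case 1
    with assms obtain \<iota> \<iota>' where *: "inj \<iota>" "F \<subseteq> {\<iota>}" "inj \<iota>'" "G \<subseteq> {\<iota>'}" by auto
    have "inj (?p \<iota> \<iota>')" using * by (simp add: inj_product_classes)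
    moreover have "product_family k F G \<subseteq> {?p \<iota> \<iota>'}"
      by (rule order_trans[OF product_family_subset[OF *(2,4)]]) auto
    ultimately have "level 0 (product_family k F G)" unfolding level.simps by blast
    with 1 show ?thesis by simp
  next
    case 2
    with assms obtain \<iota> \<iota>' \<beta> where *: "inj \<iota>" "F \<subseteq> {\<iota>}" "inj \<iota>'" "G \<subseteq> {\<iota>', \<beta>}" by auto
    have "inj (?p \<iota> \<iota>')" using * by (simp add: inj_product_classes)
    moreover have "product_family k F G \<subseteq> {?p \<iota> \<iota>', ?p \<iota> \<beta>}"
      by (rule order_trans[OF product_family_subset[OF *(2,4)]]) auto
    ultimately have "level (Suc 0) (product_family k F G)" unfolding level.simps by blast
    with 2 show ?thesis by simp
  next
    case 3
    with assms obtain \<iota> \<iota>' \<beta> where *: "inj \<iota>" "F \<subseteq> {\<iota>, \<beta>}" "inj \<iota>'" "G \<subseteq> {\<iota>'}" by auto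
    have "inj (?p \<iota> \<iota>')" using * by (simp add: inj_product_classes)
    moreover have "product_family k F G \<subseteq> {?p \<iota> \<iota>', ?p \<beta> \<iota>'}"
      by (rule order_trans[OF product_family_subset[OF *(2,4)]]) auto
    ultimately have "level (Suc 0) (product_family k F G)" unfolding level.simps by blast
    with 3 show ?thesis by simp
  next
    case 4
    with assms obtain \<iota> \<iota>' \<beta> \<beta>' where *: "inj \<iota>" "F \<subseteq> {\<iota>, \<beta>}" "inj \<iota>'" "G \<subseteq> {\<iota>', \<beta>'}" by auto
    have "inj (?p \<iota> \<iota>')" using * by (simp add: inj_product_classes)
    moreover have "\<forall>i j. ?p \<beta> \<iota>' i = ?p \<beta> \<iota>' j \<longrightarrow> ?p \<beta> \<beta>' i = ?p \<beta> \<beta>' j"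
      using * by (simp add: product_classes_eq_iff inj_eq)
    moreover have "product_family k F G \<subseteq> {?p \<iota> \<iota>', ?p \<iota> \<beta>', ?p \<beta> \<iota>', ?p \<beta> \<beta>'}"
      by (rule order_trans[OF product_family_subset[OF *(2,4)]]) auto
    ultimately have "level (Suc (Suc 0)) (product_family k F G)" unfolding level.simps by blast
    with 4 show ?thesis by simp
  next
    case 5
    with assms have "level 0 F" "level 2 G" by simp_all
    then obtain \<iota> \<iota>' \<rho> \<sigma> \<tau> where *: "inj \<iota>" "F \<subseteq> {\<iota>}" "inj \<iota>'"
      "\<forall>i j. \<sigma> i = \<sigma> j \<longrightarrow> \<tau> i = \<tau> j" "G \<subseteq> {\<iota>', \<rho>, \<sigma>, \<tau>}"
      unfolding level_2 level.simps by (elim exE conjE)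
    have "inj (?p \<iota> \<iota>')" using * by (simp add: inj_product_classes)
    moreover have "\<forall>i j. ?p \<iota> \<sigma> i = ?p \<iota> \<sigma> j \<longrightarrow> ?p \<iota> \<tau> i = ?p \<iota> \<tau> j"
      using *(4) unfolding product_classes_eq_iff by blast
    moreover have "product_family k F G \<subseteq> {?p \<iota> \<iota>', ?p \<iota> \<rho>, ?p \<iota> \<sigma>, ?p \<iota> \<tau>}"
      by (rule order_trans[OF product_family_subset[OF *(2,5)]]) auto
    ultimately have "level (Suc (Suc 0)) (product_family k F G)" unfolding level.simps by blast
    with 5 show ?thesis by (simp add: numeral_2_eq_2)
  next
    case 6
    with assms have "level 0 G" "level 2 F" by simp_all
    then obtain \<iota> \<iota>' \<rho> \<sigma> \<tau> where *: "inj \<iota>" "G \<subseteq> {\<iota>}" "inj \<iota>'"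
      "\<forall>i j. \<sigma> i = \<sigma> j \<longrightarrow> \<tau> i = \<tau> j" "F \<subseteq> {\<iota>', \<rho>, \<sigma>, \<tau>}"
      unfolding level_2 level.simps by (elim exE conjE)
    have "inj (?p \<iota>' \<iota>)" using * by (simp add: inj_product_classes)
    moreover have "\<forall>i j. ?p \<sigma> \<iota> i = ?p \<sigma> \<iota> j \<longrightarrow> ?p \<tau> \<iota> i = ?p \<tau> \<iota> j"
      using *(4) unfolding product_classes_eq_iff by blast
    moreover have "product_family k F G \<subseteq> {?p \<iota>' \<iota>, ?p \<rho> \<iota>, ?p \<sigma> \<iota>, ?p \<tau> \<iota>}"
      by (rule order_trans[OF product_family_subset[OF *(5,2)]]) auto
    ultimately have "level (Suc (Suc 0)) (product_family k F G)" unfolding level.simps by blast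
    with 6 show ?thesis by (simp add: numeral_2_eq_2)
  next
    case 7
    then obtain c where "a + b = Suc (Suc (Suc c))"
      using le_Suc_ex[of 3 "a + b"] by (auto simp: numeral_3_eq_3)
    then show ?thesis by simp
  qed
qed

lemma lookup_tensor_vec:
  assumes "Poly_Mapping.keys w \<subseteq> {..<k}" "k > 0"
  shows "Poly_Mapping.lookup (tensor_vec k v w) i
    = Poly_Mapping.lookup v (i div k) * Poly_Mapping.lookup w (i mod k)"
proof -
  let ?v = "Poly_Mapping.lookup v" and ?w = "Poly_Mapping.lookup w"
  have "Poly_Mapping.lookup (tensor_vec k v w) i
    = (\<Sum>a\<in>Poly_Mapping.keys v. \<Sum>b\<in>Poly_Mapping.keys w. if a * k + b = i then ?v a * ?w b else 0)"
    by (simp add: tensor_vec_def lookup_sum lookup_single when_def)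
  also have "\<dots> = (\<Sum>a\<in>Poly_Mapping.keys v. \<Sum>b\<in>Poly_Mapping.keys w.
      if b = i mod k then if a = i div k then ?v a * ?w b else 0 else 0)"
  proof (intro sum.cong refl)
    fix a b assume "b \<in> Poly_Mapping.keys w"
    then have "b < k" using assms by auto
    then have "(a * k + b) div k = a" "(a * k + b) mod k = b" by simp_all
    then have "a * k + b = i \<longleftrightarrow> a = i div k \<and> b = i mod k" by (metis div_mult_mod_eq)
    then show "(if a * k + b = i then ?v a * ?w b else 0)
      = (if b = i mod k then if a = i div k then ?v a * ?w b else 0 else 0)" by simp
  qed
  also have "\<dots> = ?v (i div k) * ?w (i mod k)"
    by (cases "i mod k \<in> Poly_Mapping.keys w"; cases "i div k \<in> Poly_Mapping.keys v")
      (simp_all add: in_keys_iff)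
  finally show ?thesis .
qed

lemma keys_class_vectors: "x \<in> class_vectors n F \<Longrightarrow> Poly_Mapping.keys x \<subseteq> {..<n}"
  by (auto simp: class_vectors_def in_keys_iff split: if_splits)

text \<open>Coordinatewise, a product of signed indicators is the indicator of the product class
  with the product sign.\<close>

lemma tensor_vec_class_vectors:
  assumes x: "x \<in> class_vectors n F" and y: "y \<in> class_vectors k G" and k: "k > 0"
  shows "tensor_vec k x y \<in> class_vectors (n * k) (product_family k F G)"
proof -
  from x obtain \<pi> c \<epsilon> where \<pi>: "\<pi> \<in> F" "\<epsilon> \<in> {1, -1}"
    "\<And>i. Poly_Mapping.lookup x i = (if i < n \<and> \<pi> i = c then \<epsilon> else 0)"
    unfolding class_vectors_def by blast
  from y obtain \<rho> d \<delta> where \<rho>: "\<rho> \<in> G" "\<delta> \<in> {1, -1}"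
    "\<And>i. Poly_Mapping.lookup y i = (if i < k \<and> \<rho> i = d then \<delta> else 0)"
    unfolding class_vectors_def by blast
  have "Poly_Mapping.lookup (tensor_vec k x y) i
      = (if i < n * k \<and> product_classes k \<pi> \<rho> i = prod_encode (c, d) then \<epsilon> * \<delta> else 0)" for i
  proof -
    have "i div k < n \<longleftrightarrow> i < n * k" using k by (simp add: div_less_iff_less_mult)
    then show ?thesis
      using k by (simp add: lookup_tensor_vec[OF keys_class_vectors[OF y] k] \<pi>(3) \<rho>(3) product_classes_def)
  qed
  moreover have "\<epsilon> * \<delta> \<in> {1, -1}" using \<pi>(2) \<rho>(2) by auto
  moreover have "product_classes k \<pi> \<rho> \<in> product_family k F G"
    using \<pi>(1) \<rho>(1) by (auto simp: product_family_def)
  ultimately show ?thesis unfolding class_vectors_def by blast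
qed

section \<open>Cyclotomic polytopes\<close>

text \<open>Its cardinality is the level of the family for \<open>m\<close>; it is additive on
  coprime factors, as levels are under products.\<close>

definition odd_primes :: "nat \<Rightarrow> nat set" where
  "odd_primes m = {p. prime p \<and> odd p \<and> p dvd m}"

lemma finite_odd_primes: "m > 0 \<Longrightarrow> finite (odd_primes m)"
  by (rule finite_subset[of _ "{..m}"]) (auto simp: odd_primes_def dvd_imp_le)

lemma odd_primes_prime_power:
  assumes "prime p" "\<alpha> \<ge> 1"
  shows "odd_primes (p ^ \<alpha>) = (if p = 2 then {} else {p})"
proof -
  have "prime r \<and> r dvd p ^ \<alpha> \<longleftrightarrow> r = p" for r
    using assms by (auto simp: prime_dvd_power_iff primes_dvd_imp_eq dest: prime_dvd_power)
  then have "odd_primes (p ^ \<alpha>) = {r. r = p \<and> odd r}" unfolding odd_primes_def by blast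
  moreover have "odd p \<longleftrightarrow> p \<noteq> 2" using assms(1) by (metis even_numeral primes_dvd_imp_eq two_is_prime_nat)
  ultimately show ?thesis by auto
qed

lemma card_odd_primes_mult:
  assumes "coprime a b" "a > 0" "b > 0"
  shows "card (odd_primes (a * b)) = card (odd_primes a) + card (odd_primes b)"
proof -
  have "odd_primes (a * b) = odd_primes a \<union> odd_primes b"
    by (auto simp: odd_primes_def prime_dvd_mult_iff)
  moreover have "odd_primes a \<inter> odd_primes b = {}"
    unfolding odd_primes_def using coprime_common_divisor_nat[OF assms(1)] not_prime_1 by blast
  ultimately show ?thesis using assms finite_odd_primes by (simp add: card_Un_disjoint)
qed

text \<open>For p = 2 the divisor p - 1 is 1, and the two partitions coincide.\<close>

lemma level_prime_power:
  assumes "prime p" "\<alpha> \<ge> 1"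
  shows "level (card (odd_primes (p ^ \<alpha>))) {\<lambda>i. i, \<lambda>i. i div (p - 1)}"
proof (cases "p = 2")
  case True
  have "inj (\<lambda>i::nat. i)" by (simp add: inj_def)
  then show ?thesis unfolding odd_primes_prime_power[OF assms] using True by auto
next
  case False
  have "inj (\<lambda>i::nat. i)" by (simp add: inj_def)
  then have "level (Suc 0) {\<lambda>i. i, \<lambda>i. i div (p - 1)}" unfolding level.simps by blast
  then show ?thesis using False by (simp add: odd_primes_prime_power[OF assms])
qed

lemma std_basis_class_vector:
  assumes "i < n" "(\<lambda>i. i) \<in> F"
  shows "std_basis i \<in> class_vectors n F"
  unfolding class_vectors_def mem_Collect_eq
  using assms by (intro bexI[of _ "\<lambda>i. i"] exI[of _ i] bexI[of _ 1]) (auto simp: lookup_single when_def)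

lemma cyclotomic_polytope_class_vectors:
  assumes "cyclotomic_polytope m P"
  shows "\<exists>F V. P = convex hull V \<and> V \<subseteq> class_vectors (totient m) F \<and> level (card (odd_primes m)) F"
  using assms
proof (induction rule: cyclotomic_polytope.induct)
  case (prime p)
  let ?F = "{\<lambda>i. i, \<lambda>i. i div (p - 1)}"
  have tot: "totient p = p - 1" using prime by (rule totient_prime)
  \<comment> \<open>All coordinates below \<open>p - 1\<close> form the class 0 of
    \<open>i div (p - 1)\<close>.\<close>
  have "- (\<Sum>i<p - 1. std_basis i) \<in> class_vectors (p - 1) ?F"
    unfolding class_vectors_def mem_Collect_eq
    by (intro bexI[of _ "\<lambda>i. i div (p - 1)"] exI[of _ 0] bexI[of _ "-1"])
      (auto simp: lookup_sum lookup_single when_def)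
  then have "insert (- (\<Sum>i<p - 1. std_basis i)) (std_basis ` {..<p - 1}) \<subseteq> class_vectors (totient p) ?F"
    unfolding tot by (auto intro: std_basis_class_vector)
  moreover have "level (card (odd_primes p)) ?F"
    using level_prime_power[OF prime, of 1] by simp
  ultimately show ?case unfolding prime_cyclotomic_polytope_def by blast
next
  case (prime_power p \<alpha>)
  let ?F = "{\<lambda>i. i, \<lambda>i. i div (p - 1)}"
  have "x \<in> class_vectors (totient (p ^ \<alpha>)) ?F" if x: "represents p \<alpha> x (zeta (p ^ \<alpha>) ^ a)" for x a
  proof -
    have \<alpha>: "\<alpha> \<ge> 1" using prime_power by simp
    from represents_root_power[OF prime_power(1) \<alpha> x] show ?thesis
    proof (elim disjE exE conjE)
      fix i assume "i < totient (p ^ \<alpha>)" "x = std_basis i"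
      then show ?thesis by (auto intro: std_basis_class_vector)
    next
      fix k assume "\<forall>i. Poly_Mapping.lookup x i = (if i < totient (p ^ \<alpha>) \<and> i div (p - 1) = k then -1 else 0)"
      then show ?thesis
        unfolding class_vectors_def mem_Collect_eq
        by (intro bexI[of _ "\<lambda>i. i div (p - 1)"] exI[of _ k] bexI[of _ "-1"]) auto
    qed
  qed
  then have "{x. \<exists>a::nat. represents p \<alpha> x (zeta (p ^ \<alpha>) ^ a)} \<subseteq> class_vectors (totient (p ^ \<alpha>)) ?F" by blast
  moreover have "level (card (odd_primes (p ^ \<alpha>))) ?F"
    using prime_power by (intro level_prime_power) auto
  ultimately show ?case unfolding prime_power_cyclotomic_polytope_def by blast
next
  case (coprime m\<^sub>1 m\<^sub>2 P Q)
  from coprime.IH obtain F V G W where V: "P = convex hull V" "V \<subseteq> class_vectors (totient m\<^sub>1) F"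
      "level (card (odd_primes m\<^sub>1)) F"
    and W: "Q = convex hull W" "W \<subseteq> class_vectors (totient m\<^sub>2) G" "level (card (odd_primes m\<^sub>2)) G"
    by blast
  let ?T = "{tensor_vec (totient m\<^sub>2) v w |v w. v extreme_point_of P \<and> w extreme_point_of Q}"
  have m: "m\<^sub>1 > 0" "m\<^sub>2 > 0" using coprime.hyps by simp_all
  have "?T \<subseteq> class_vectors (totient m\<^sub>1 * totient m\<^sub>2) (product_family (totient m\<^sub>2) F G)"
  proof clarify
    fix v w assume "v extreme_point_of P" "w extreme_point_of Q"
    \<comment> \<open>Extreme points of a convex hull belong to any generating set, so the inductive
      description of \<open>V\<close> and \<open>W\<close> covers them.\<close>
    then have "v \<in> V" "w \<in> W" using V(1) W(1) extreme_point_of_convex_hull by blast+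
    then show "tensor_vec (totient m\<^sub>2) v w
        \<in> class_vectors (totient m\<^sub>1 * totient m\<^sub>2) (product_family (totient m\<^sub>2) F G)"
      using V(2) W(2) m by (intro tensor_vec_class_vectors) auto
  qed
  moreover have "level (card (odd_primes (m\<^sub>1 * m\<^sub>2))) (product_family (totient m\<^sub>2) F G)"
    using level_product_family[OF V(3) W(3)] coprime.hyps m by (simp add: card_odd_primes_mult)
  ultimately show ?case
    unfolding tensor_polytope_def using coprime.hyps by (auto simp: totient_mult_coprime)
qed

lemma finite_class_vectors:
  assumes "finite F"
  shows "finite (class_vectors n F)"
proof -
  have "inj (Poly_Mapping.lookup :: (nat \<Rightarrow>\<^sub>0 real) \<Rightarrow> _)"
    by (rule injI) (simp add: poly_mapping_eqI)
  moreover have "finite {f. (\<forall>i. i \<notin> {..<n} \<longrightarrow> f i = 0) \<and> (\<forall>i\<in>{..<n}. f i \<in> {0, 1, -1 :: real})}"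
    by (rule finite_subset[OF _ finite_set_of_finite_funs[of "{..<n}" "{0, 1, -1}" 0]]) auto
  then have "finite (Poly_Mapping.lookup ` class_vectors n F)"
    by (rule rev_finite_subset) (auto simp: class_vectors_def)
  ultimately show ?thesis by (metis finite_imageD inj_on_subset subset_UNIV)
qed

text \<open>Shorter lists of partitions are padded by repetition; with \<open>\<sigma>\<close> and
  \<open>\<tau>\<close> equal, the coarsening condition is trivial.\<close>

lemma level_mono:
  assumes "level a F" "a \<le> 2"
  shows "level 2 F"
proof -
  consider "a = 0" | "a = 1" | "a = 2" using assms(2) by linarith
  then show ?thesis
  proof cases
    case 1
    with assms(1) obtain \<iota> where "inj \<iota>" "F \<subseteq> {\<iota>, \<iota>, \<iota>, \<iota>}" by auto
    then show ?thesis unfolding level_2 by blast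
  next
    case 2
    with assms(1) obtain \<iota> \<beta> where "inj \<iota>" "F \<subseteq> {\<iota>, \<beta>, \<beta>, \<beta>}" by auto
    then show ?thesis unfolding level_2 by blast
  qed (use assms in simp)
qed

text \<open>The lattice points of the hull lie in \<open>V\<close> or are the origin, so they all
  are admissible columns.\<close>

lemma totally_unimodular_polytope_class_vectors:
  assumes V: "V \<subseteq> class_vectors n F" and F: "level 2 F"
  shows "totally_unimodular_polytope n (convex hull V)"
proof -
  from F obtain \<iota> \<rho> \<sigma> \<tau> where level: "inj \<iota>" "\<forall>i j. \<sigma> i = \<sigma> j \<longrightarrow> \<tau> i = \<tau> j" "F \<subseteq> {\<iota>, \<rho>, \<sigma>, \<tau>}"
    unfolding level_2 by (elim exE conjE)
  \<comment> \<open>All four partitions are taken, even if \<open>F\<close> is smaller, because the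
    classes of \<open>\<iota>\<close> supply the standard basis vectors.\<close>
  define C where "C = class_vectors n {\<iota>, \<rho>, \<sigma>, \<tau>}"
  have VC: "V \<subseteq> C" using V level(3) unfolding C_def class_vectors_def by blast
  have "finite C" unfolding C_def by (rule finite_class_vectors) simp
  then have "finite V" using VC finite_subset by blast
  have keys: "Poly_Mapping.keys v \<subseteq> {..<n}" if "v \<in> C" for v
    using that keys_class_vectors unfolding C_def by blast
  have lat: "lattice_point n v" if "v \<in> C" for v
    using that keys[OF that] by (auto simp: lattice_point_def C_def class_vectors_def)
  have sC: "signable_mat (Matrix.mat n (length xs) (\<lambda>(i, j). Poly_Mapping.lookup (xs ! j) i))"
    if "set xs \<subseteq> insert 0 C" for xs
    by (rule signable_mat_class_vectors[OF subset_refl level(1) level(2)[rule_format] that[unfolded C_def]])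
  then have "signable_set n C" by (auto simp: signable_set_def)
  moreover have "std_basis ` {..<n} \<subseteq> C"
  proof clarify
    fix i assume "i < n"
    then show "std_basis i \<in> C"
      unfolding C_def class_vectors_def mem_Collect_eq
      by (intro bexI[of _ \<iota>] exI[of _ "\<iota> i"] bexI[of _ 1]) (auto simp: lookup_single when_def inj_eq[OF level(1)])
  qed
  ultimately have sub: "{x \<in> convex hull V. lattice_point n x} \<subseteq> insert 0 V"
    using lattice_points_convex_hull[of n C V] keys VC by blast
  then have "finite {x \<in> convex hull V. lattice_point n x}"
    using \<open>finite V\<close> by (meson finite.insertI finite_subset)
  then obtain xs where xs: "set xs = {x \<in> convex hull V. lattice_point n x}" "distinct xs"
    using finite_distinct_list by blast
  have "signable_mat (Matrix.mat n (length xs) (\<lambda>(i, j). Poly_Mapping.lookup (xs ! j) i))"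
    using sub VC xs(1) by (intro sC) blast
  then show ?thesis
    unfolding totally_unimodular_polytope_def lattice_polytope_def
    using xs \<open>finite V\<close> lat VC totally_unimodular_if_signable by blast
qed

theorem theorem3p5:
  fixes m :: nat and P :: "(nat \<Rightarrow>\<^sub>0 real) set"
  assumes form:
    "(\<exists>p \<alpha>. prime p \<and> \<alpha> \<ge> 1 \<and> m = p ^ \<alpha>) \<or>
     (\<exists>p q \<alpha> \<beta>. prime p \<and> prime q \<and> p \<noteq> q \<and> \<alpha> \<ge> 1 \<and> \<beta> \<ge> 1 \<and> m = p ^ \<alpha> * q ^ \<beta>) \<or>
     (\<exists>p q \<alpha> \<beta> \<gamma>. prime p \<and> prime q \<and> odd p \<and> odd q \<and> p \<noteq> q \<and>
        \<alpha> \<ge> 1 \<and> \<beta> \<ge> 1 \<and> \<gamma> \<ge> 1 \<and> m = 2 ^ \<alpha> * p ^ \<beta> * q ^ \<gamma>)"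
    and cyclotomic: "cyclotomic_polytope m P"
  shows "totally_unimodular_polytope (totient m) P"
proof -
  have *: "r = p" if "prime r" "prime p" "r dvd p ^ k" for r p k :: nat
    using that by (metis prime_dvd_power primes_dvd_imp_eq)
  \<comment> \<open>Every prime factor of \<open>m\<close> other than 2 is one of at most two
    primes; the pair may repeat a prime or contain 2.\<close>
  have sub: "\<exists>p q. odd_primes m \<subseteq> {p, q}"
    using form
  proof (elim disjE exE conjE)
    fix p \<alpha> assume "prime p" "m = p ^ \<alpha>"
    then have "odd_primes m \<subseteq> {p, p}"
      unfolding odd_primes_def using * by blast
    then show ?thesis by blast
  next
    fix p q \<alpha> \<beta> assume "prime p" "prime q" "m = p ^ \<alpha> * q ^ \<beta>"
    then have "odd_primes m \<subseteq> {p, q}"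
      unfolding odd_primes_def using * by (auto simp: prime_dvd_mult_iff)
    then show ?thesis by blast
  next
    fix p q \<alpha> \<beta> \<gamma> assume "prime p" "prime q" "m = 2 ^ \<alpha> * p ^ \<beta> * q ^ \<gamma>"
    then have "r = 2 \<or> r = p \<or> r = q" if "prime r" "r dvd m" for r
      using that * two_is_prime_nat by (auto simp: prime_dvd_mult_iff)
    moreover have "even (2 :: nat)" by simp
    ultimately have "odd_primes m \<subseteq> {p, q}" unfolding odd_primes_def by blast
    then show ?thesis by blast
  qed
  then obtain p q where "odd_primes m \<subseteq> {p, q}" by blast
  then have "card (odd_primes m) \<le> card {p, q}" by (intro card_mono) auto
  also have "\<dots> \<le> 2" by (simp add: card_insert_if)
  finally have "card (odd_primes m) \<le> 2" .
  moreover obtain F V where "P = convex hull V" "V \<subseteq> class_vectors (totient m) F"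
    "level (card (odd_primes m)) F"
    using cyclotomic_polytope_class_vectors[OF cyclotomic] by blast
  ultimately show ?thesis
    using level_mono totally_unimodular_polytope_class_vectors by blast
qed

end
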